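(* Let $N$ be a positive integer, $L_1\ge\cdots\ge L_K$ nonnegative integers with $L_1\le N$, and $M=\sum_i L_i$ with $M\ge N$. Then $c((N^{L_1}),\ldots,(N^{L_K});(M^N))=c(((M-N)^{L_1}),\ldots,((M-N)^{L_K});(M^{M-N}))$.
   Context: Littlewood–Richardson coefficients are defined by $\prod_i s_{\lambda^i}=\sum_\mu c(\lambda^1,\ldots,\lambda^K;\mu)s_\mu$ for Schur polynomials $s_\lambda$; $(a^b)$ denotes the rectangular partition with $b$ parts equal to $a$ (empty if $a=0$ or $b=0$). *)

theory Defs
  imports Main "HOL-Library.Poly_Mapping"
begin

definition is_partition :: "nat list \<Rightarrow> bool" where
  "is_partition lam \<longleftrightarrow> sorted_wrt (\<ge>) lam \<and> (\<forall>x\<in>set lam. 0 < x)"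

definition rect :: "nat \<Rightarrow> nat \<Rightarrow> nat list" where
  "rect a b = (if a = 0 then [] else replicate b a)"

definition cells :: "nat list \<Rightarrow> (nat \<times> nat) set" where
  "cells lam = {(i, j). i < length lam \<and> j < lam ! i}"

definition ssyt :: "nat \<Rightarrow> nat list \<Rightarrow> (nat \<times> nat \<Rightarrow> nat) set" where
  "ssyt n lam = {T. (\<forall>c. c \<notin> cells lam \<longrightarrow> T c = 0)
     \<and> (\<forall>c\<in>cells lam. T c < n)
     \<and> (\<forall>i j. (i, Suc j) \<in> cells lam \<longrightarrow> T (i, j) \<le> T (i, Suc j))
     \<and> (\<forall>i j. (Suc i, j) \<in> cells lam \<longrightarrow> T (i, j) < T (Suc i, j))}"

type_synonym mpoly = "(nat \<Rightarrow>\<^sub>0 nat) \<Rightarrow>\<^sub>0 int"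

definition tab_monomial :: "nat list \<Rightarrow> (nat \<times> nat \<Rightarrow> nat) \<Rightarrow> mpoly" where
  "tab_monomial lam T =
     Poly_Mapping.single (\<Sum>c\<in>cells lam. Poly_Mapping.single (T c) (1::nat)) (1::int)"

definition schur :: "nat \<Rightarrow> nat list \<Rightarrow> mpoly" where
  "schur n lam = (\<Sum>T\<in>ssyt n lam. tab_monomial lam T)"

text \<open>Littlewood--Richardson coefficient c(lam^1,...,lam^K; mu), defined by
  prod_i s_{lam^i} = sum_mu c(...;mu) s_mu, computed in d = sum |lam^i|
  variables (enough variables so that all s_mu with |mu| = d are nonzero
  and linearly independent; the expansion is stable).\<close>
definition lr_coeff :: "nat list list \<Rightarrow> nat list \<Rightarrow> int" where
  "lr_coeff lams mu =
    (let d = sum_list (map sum_list lams);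
         P = {nu. is_partition nu \<and> sum_list nu = d};
         c = (THE c. (\<forall>nu. nu \<notin> P \<longrightarrow> c nu = 0) \<and>
               prod_list (map (schur d) lams) =
                 (\<Sum>nu\<in>P. Poly_Mapping.single 0 (c nu) * schur d nu))
     in c mu)"

end

theory Submission
  imports Defs "HOL-Library.FuncSet"
begin

text \<open>Littlewood--Richardson coefficients are invariant under conjugating all partitions, so the left-hand
  side is the coefficient of \<open>(N^M)\<close> in the product of the \<open>s\<close> of \<open>(L_i^N)\<close>. In \<open>M\<close> variables the
  substitution of \<open>x^{-1}\<close> for \<open>x\<close> followed by multiplication with \<open>(x_1 ... x_M)^b\<close> replaces a partition
  by its complement in the box with \<open>M\<close> rows and \<open>b\<close> columns. With \<open>b = L_i\<close> it turns \<open>(L_i^N)\<close> into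
  \<open>(L_i^{M-N})\<close>; on the product, where \<open>b = M\<close>, it turns \<open>(N^M)\<close> into \<open>((M-N)^M)\<close>. Conjugating back
  gives the right-hand side.

  Conjugation invariance follows from the two Pieri rules: multiplication by \<open>h_k\<close> adds horizontal
  strips, multiplication by \<open>e_k\<close> adds vertical strips, and every Schur polynomial is obtained
  recursively from smaller ones by multiplying with \<open>h_k\<close> and subtracting.\<close>

section \<open>Partitions and horizontal strips\<close>

text \<open>The obstacle is the number of variables. \<open>lr_coeff\<close> works in
  \<open>N * M\<close> variables on one side and in \<open>(M - N) * M\<close> on the other, whereas
  complementation links the two products in exactly \<open>M\<close> variables, where Schur
  polynomials of partitions with more than \<open>M\<close> rows vanish. The expansions are
  therefore built with coefficients that do not depend on the number \<open>n\<close> of variables: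
  they are identified with Littlewood-Richardson coefficients in many variables and compared in
  \<open>M\<close> variables, where both target rectangles survive. Conjugation comes first because
  all boxes must share their number of rows, which is the number of variables, while their widths
  add up under multiplication. After it every factor occupies \<open>N\<close> of the
  \<open>M\<close> rows, and the widths \<open>L_i\<close> add up to \<open>M\<close>. Schur
  polynomials are defined by recursion on the number of variables, so that the Pieri rule and
  complementation both become inductions about interlacing sequences.\<close>

definition par :: "(nat \<Rightarrow> nat) set" where
  "par = {p. (\<forall>i. p (Suc i) \<le> p i) \<and> (\<exists>m. \<forall>i\<ge>m. p i = 0)}"

definition psize :: "(nat \<Rightarrow> nat) \<Rightarrow> nat" where
  "psize p = (\<Sum>i | p i \<noteq> 0. p i)"

definition parts :: "nat \<Rightarrow> (nat \<Rightarrow> nat) set" where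
  "parts d = {p \<in> par. psize p = d}"

text \<open>Interlacing says that the skew shape has at most one cell in each column. For a fixed
  outer (or inner) sequence every row of the other one ranges over an interval of its own; the
  reflection and the sign-reversing involution below change rows within these intervals.\<close>

definition hstrip :: "(nat \<Rightarrow> nat) \<Rightarrow> (nat \<Rightarrow> nat) \<Rightarrow> bool" where
  "hstrip \<mu> \<alpha> \<longleftrightarrow> (\<forall>i. \<mu> i \<le> \<alpha> i \<and> \<alpha> (Suc i) \<le> \<mu> i)"

lemma par_antimono: "p \<in> par \<Longrightarrow> i \<le> j \<Longrightarrow> p j \<le> p i"
  by (rule lift_Suc_antimono_le[of p]) (auto simp: par_def)

lemma par_bound: "p \<in> par \<Longrightarrow> \<exists>m. \<forall>i\<ge>m. p i = 0"
  by (simp add: par_def)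

lemma par_zeroD: "p \<in> par \<Longrightarrow> p n = 0 \<Longrightarrow> n \<le> i \<Longrightarrow> p i = 0"
  using par_antimono[of p n i] by simp

lemma psize_eq_sum: "\<forall>i\<ge>m. p i = 0 \<Longrightarrow> psize p = (\<Sum>i<m. p i)"
  unfolding psize_def by (rule sum.mono_neutral_left) (auto intro: ccontr)

lemma par_zero [simp]: "(\<lambda>_. 0) \<in> par"
  by (simp add: par_def)

lemma psize_zero [simp]: "psize (\<lambda>_. 0) = 0"
  by (simp add: psize_def)

lemma psize_mono:
  assumes "q \<in> par" "\<And>i. p i \<le> q i"
  shows "psize p \<le> psize q"
proof -
  obtain m where m: "\<forall>i\<ge>m. q i = 0" using assms(1) par_bound by blast
  then have "\<forall>i\<ge>m. p i = 0" using assms(2) by (metis le_zero_eq)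
  then show ?thesis using m by (simp add: psize_eq_sum sum_mono assms(2))
qed

lemma psize_eq_imp_eq:
  assumes "q \<in> par" "\<And>i. p i \<le> q i" "psize p = psize q"
  shows "p = q"
proof (rule ccontr)
  assume "p \<noteq> q"
  then obtain k where k: "p k < q k" using assms(2) by (metis ext le_neq_implies_less)
  obtain m where m: "\<forall>i\<ge>m. q i = 0" using assms(1) par_bound by blast
  have pm: "\<forall>i\<ge>m. p i = 0" using assms(2) m by (metis le_zero_eq)
  have "k < m" using k m by (metis not_less_zero not_le)
  then have "(\<Sum>i<m. p i) < (\<Sum>i<m. q i)"
    using k assms(2) by (intro sum_strict_mono_ex1) auto
  then show False using m pm assms(3) by (simp add: psize_eq_sum)
qed

lemma psize_zero_iff: "p \<in> par \<Longrightarrow> psize p = 0 \<longleftrightarrow> p = (\<lambda>_. 0)"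
  using psize_eq_imp_eq[of p "\<lambda>_. 0"] by fastforce

lemma parts_le:
  assumes "p \<in> parts d" shows "p i \<le> d"
proof -
  have "p \<in> par" using assms by (simp add: parts_def)
  then obtain m where m: "\<forall>i\<ge>m. p i = 0" using par_bound by blast
  show ?thesis
  proof (cases "i < m")
    case True
    have "p i \<le> (\<Sum>i<m. p i)" using True by (intro member_le_sum) auto
    then show ?thesis using assms m by (auto simp: parts_def psize_eq_sum)
  qed (use m in auto)
qed

text \<open>A nonzero row with index \<open>d\<close> would force \<open>d + 1\<close> nonzero rows.
  Hence \<open>d\<close> variables are enough to keep all Schur polynomials of degree
  \<open>d\<close> alive.\<close>

lemma parts_length:
  assumes "p \<in> parts d" shows "p d = 0"
proof (rule ccontr)
  assume "p d \<noteq> 0"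
  have p: "p \<in> par" "psize p = d" using assms by (auto simp: parts_def)
  obtain m where m: "\<forall>i\<ge>m. p i = 0" using p par_bound by blast
  have "d < m" using \<open>p d \<noteq> 0\<close> m by (meson not_le)
  have "Suc d = (\<Sum>i<Suc d. 1)" by simp
  also have "\<dots> \<le> (\<Sum>i<Suc d. p i)"
  proof (rule sum_mono)
    fix i assume "i \<in> {..<Suc d}"
    then have "p d \<le> p i" using par_antimono[OF p(1), of i d] by auto
    then show "1 \<le> p i" using \<open>p d \<noteq> 0\<close> by auto
  qed
  also have "\<dots> \<le> (\<Sum>i<m. p i)" using \<open>d < m\<close> by (intro sum_mono2) auto
  finally show False using p m by (simp add: psize_eq_sum)
qed

lemma finite_bounded_funs: "finite {p :: nat \<Rightarrow> nat. (\<forall>i. p i \<le> b) \<and> (\<forall>i\<ge>m. p i = 0)}"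
proof -
  have "finite {f. \<forall>x. (x \<in> {..<m} \<longrightarrow> f x \<in> {..b}) \<and> (x \<notin> {..<m} \<longrightarrow> f x = (0::nat))}"
    by (rule finite_set_of_finite_funs) auto
  then show ?thesis by (rule rev_finite_subset) auto
qed

lemma finite_parts [simp]: "finite (parts d)"
proof (rule finite_subset[OF _ finite_bounded_funs[of d d]])
  have "p i = 0" if "p \<in> parts d" "i \<ge> d" for p i
    using par_zeroD[of p d i] parts_length[of p d] that by (simp add: parts_def)
  then show "parts d \<subseteq> {p. (\<forall>i. p i \<le> d) \<and> (\<forall>i\<ge>d. p i = 0)}"
    by (simp add: subset_iff parts_le)
qed

lemma hstrip_le: "hstrip \<mu> \<alpha> \<Longrightarrow> \<mu> i \<le> \<alpha> i"
  by (simp add: hstrip_def)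

lemma hstrip_Suc_le: "hstrip \<mu> \<alpha> \<Longrightarrow> \<alpha> (Suc i) \<le> \<mu> i"
  by (simp add: hstrip_def)

lemma parI: "(\<And>i. p (Suc i) \<le> p i) \<Longrightarrow> (\<And>i. m \<le> i \<Longrightarrow> p i = 0) \<Longrightarrow> p \<in> par"
  by (auto simp: par_def)

lemma hstrip_par_inner:
  assumes "hstrip \<mu> \<alpha>" "\<alpha> \<in> par" shows "\<mu> \<in> par"
proof -
  obtain m where m: "\<forall>i\<ge>m. \<alpha> i = 0" using par_bound[OF assms(2)] by blast
  show ?thesis
  proof (rule parI)
    show "\<mu> (Suc i) \<le> \<mu> i" for i
      using hstrip_le[OF assms(1), of "Suc i"] hstrip_Suc_le[OF assms(1), of i] by simp
    show "\<mu> i = 0" if "m \<le> i" for i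
      using hstrip_le[OF assms(1), of i] m that by simp
  qed
qed

lemma hstrip_par_outer:
  assumes "hstrip \<alpha> \<mu>" "\<alpha> \<in> par" shows "\<mu> \<in> par"
proof -
  obtain m where m: "\<forall>i\<ge>m. \<alpha> i = 0" using par_bound[OF assms(2)] by blast
  show ?thesis
  proof (rule parI)
    show "\<mu> (Suc i) \<le> \<mu> i" for i
      using hstrip_le[OF assms(1), of i] hstrip_Suc_le[OF assms(1), of i] by simp
    show "\<mu> i = 0" if i: "Suc m \<le> i" for i
    proof -
      obtain j where "i = Suc j" "m \<le> j" using i by (cases i) auto
      then show ?thesis using hstrip_Suc_le[OF assms(1), of j] m by simp
    qed
  qed
qed

lemma hstrip_psize: "hstrip \<mu> \<alpha> \<Longrightarrow> \<alpha> \<in> par \<Longrightarrow> psize \<mu> \<le> psize \<alpha>"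
  by (rule psize_mono) (auto simp: hstrip_le)

lemma finite_hstrip_inner:
  assumes "\<alpha> \<in> par" shows "finite {\<mu>. hstrip \<mu> \<alpha>}"
proof -
  obtain m where m: "\<forall>i\<ge>m. \<alpha> i = 0" using par_bound[OF assms] by blast
  have "{\<mu>. hstrip \<mu> \<alpha>} \<subseteq> {p. (\<forall>i. p i \<le> \<alpha> 0) \<and> (\<forall>i\<ge>m. p i = 0)}"
  proof (clarsimp, intro conjI allI impI)
    fix \<mu> i assume h: "hstrip \<mu> \<alpha>"
    show "\<mu> i \<le> \<alpha> 0"
      using hstrip_le[OF h, of i] par_antimono[OF assms, of 0 i] by simp
    show "\<mu> i = 0" if "m \<le> i" using hstrip_le[OF h, of i] m that by simp
  qed
  then show ?thesis using finite_bounded_funs by (rule finite_subset)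
qed

definition hstrips :: "(nat \<Rightarrow> nat) \<Rightarrow> nat \<Rightarrow> (nat \<Rightarrow> nat) set" where
  "hstrips \<alpha> k = {\<mu>. hstrip \<alpha> \<mu> \<and> psize \<mu> = psize \<alpha> + k}"

lemma hstrips_subset: "\<alpha> \<in> par \<Longrightarrow> hstrips \<alpha> k \<subseteq> parts (psize \<alpha> + k)"
  by (auto simp: hstrips_def parts_def hstrip_par_outer)

lemma finite_hstrips: "\<alpha> \<in> par \<Longrightarrow> finite (hstrips \<alpha> k)"
  using hstrips_subset finite_parts finite_subset by blast

section \<open>Schur polynomials\<close>

definition xpow :: "nat \<Rightarrow> nat \<Rightarrow> mpoly" where
  "xpow i k = Poly_Mapping.single (Poly_Mapping.single i k) 1"

lemma xpow_0 [simp]: "xpow i 0 = 1"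
  by (simp add: xpow_def)

lemma xpow_add: "xpow i (j + k) = xpow i j * xpow i k"
  by (simp add: xpow_def mult_single single_add)

text \<open>A tableau with entries at most \<open>n\<close> is peeled along the cells with entry \<open>n\<close>, which form
  a horizontal strip: these are Gelfand--Tsetlin patterns read row by row.\<close>

primrec gtschur :: "nat \<Rightarrow> (nat \<Rightarrow> nat) \<Rightarrow> mpoly" where
  "gtschur 0 \<alpha> = (if \<alpha> = (\<lambda>_. 0) then 1 else 0)"
| "gtschur (Suc n) \<alpha> = (\<Sum>\<mu> | hstrip \<mu> \<alpha>. xpow n (psize \<alpha> - psize \<mu>) * gtschur n \<mu>)"

lemma gtschur_zero [simp]: "gtschur n (\<lambda>_. 0) = 1"
proof (induction n)
  case (Suc n)
  have "{\<mu>. hstrip \<mu> (\<lambda>_. 0)} = {\<lambda>_. 0}" by (auto simp: hstrip_def)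
  then show ?case using Suc by simp
qed simp

text \<open>Interlacing hands a nonzero entry \<open>\<alpha> (Suc n)\<close> on to
  \<open>\<mu> n\<close>, so the recursion ends at a nonzero sequence in zero variables. This allows
  later sums to be cut down to partitions with at most \<open>n\<close> rows.\<close>

lemma gtschur_long: "\<alpha> n \<noteq> 0 \<Longrightarrow> gtschur n \<alpha> = 0"
proof (induction n arbitrary: \<alpha>)
  case 0
  then have "\<alpha> \<noteq> (\<lambda>_. 0)" by metis
  then show ?case by simp
next
  case (Suc n)
  have "gtschur n \<mu> = 0" if "hstrip \<mu> \<alpha>" for \<mu>
    using Suc.IH[of \<mu>] Suc.prems hstrip_Suc_le[OF that, of n] by simp
  then show ?case by simp
qed

section \<open>Semistandard tableaux and Gelfand-Tsetlin patterns\<close>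

definition diagram :: "(nat \<Rightarrow> nat) \<Rightarrow> (nat \<times> nat) set" where
  "diagram p = {(i, j). j < p i}"

definition tableaux :: "nat \<Rightarrow> (nat \<Rightarrow> nat) \<Rightarrow> (nat \<times> nat \<Rightarrow> nat) set" where
  "tableaux n p = {T. (\<forall>c. c \<notin> diagram p \<longrightarrow> T c = 0)
     \<and> (\<forall>c\<in>diagram p. T c < n)
     \<and> (\<forall>i j. (i, Suc j) \<in> diagram p \<longrightarrow> T (i, j) \<le> T (i, Suc j))
     \<and> (\<forall>i j. (Suc i, j) \<in> diagram p \<longrightarrow> T (i, j) < T (Suc i, j))}"

definition weight :: "(nat \<Rightarrow> nat) \<Rightarrow> (nat \<times> nat \<Rightarrow> nat) \<Rightarrow> mpoly" where
  "weight p T = Poly_Mapping.single (\<Sum>c\<in>diagram p. Poly_Mapping.single (T c) (1::nat)) (1::int)"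

lemma diagram_finite_card:
  assumes "p \<in> par" shows "finite (diagram p)" "card (diagram p) = psize p"
proof -
  obtain m where m: "\<forall>i\<ge>m. p i = 0" using par_bound[OF assms] by blast
  have "diagram p = Sigma {..<m} (\<lambda>i. {..<p i})"
    using m by (auto simp: diagram_def intro: ccontr)
  then show "finite (diagram p)" "card (diagram p) = psize p"
    by (simp_all add: psize_eq_sum[OF m])
qed

lemma finite_tableaux:
  assumes "p \<in> par" shows "finite (tableaux n p)"
proof -
  have "finite {T. \<forall>c. (c \<in> diagram p \<longrightarrow> T c \<in> {..<n}) \<and> (c \<notin> diagram p \<longrightarrow> T c = (0::nat))}"
    using diagram_finite_card(1)[OF assms] by (intro finite_set_of_finite_funs) auto
  then show ?thesis by (rule rev_finite_subset) (auto simp: tableaux_def)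
qed

text \<open>The number of entries below \<open>n\<close> in row \<open>i\<close>. Since
  \<open>T\<close> takes the value 0 outside the diagram, the conjunct \<open>j < p i\<close> is
  what ends the row.\<close>

definition inner_shape :: "nat \<Rightarrow> (nat \<Rightarrow> nat) \<Rightarrow> (nat \<times> nat \<Rightarrow> nat) \<Rightarrow> nat \<Rightarrow> nat" where
  "inner_shape n p T i = (LEAST j. \<not> (j < p i \<and> T (i, j) < n))"

definition inner_tableau :: "(nat \<Rightarrow> nat) \<Rightarrow> (nat \<times> nat \<Rightarrow> nat) \<Rightarrow> nat \<times> nat \<Rightarrow> nat" where
  "inner_tableau \<mu> T c = (if c \<in> diagram \<mu> then T c else 0)"

definition outer_tableau :: "nat \<Rightarrow> (nat \<Rightarrow> nat) \<Rightarrow> (nat \<Rightarrow> nat) \<Rightarrow> (nat \<times> nat \<Rightarrow> nat) \<Rightarrow> nat \<times> nat \<Rightarrow> nat" where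
  "outer_tableau n p \<mu> T c = (if c \<in> diagram \<mu> then T c else if c \<in> diagram p then n else 0)"

lemma tableau_row_mono:
  assumes "T \<in> tableaux n p" "j \<le> k" "k < p i"
  shows "T (i, j) \<le> T (i, k)"
  using assms(2,3)
proof (induction k rule: dec_induct)
  case (step k)
  have "T (i, k) \<le> T (i, Suc k)"
    using assms(1) step.prems by (simp add: tableaux_def diagram_def)
  then show ?case using step by simp
qed simp

lemma less_inner_shape_iff:
  assumes "T \<in> tableaux n' p"
  shows "j < inner_shape n p T i \<longleftrightarrow> j < p i \<and> T (i, j) < n"
proof
  assume "j < inner_shape n p T i"
  then show "j < p i \<and> T (i, j) < n"
    unfolding inner_shape_def using not_less_Least by blast
next
  assume j: "j < p i \<and> T (i, j) < n"
  have "\<not> (inner_shape n p T i < p i \<and> T (i, inner_shape n p T i) < n)"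
    unfolding inner_shape_def by (rule LeastI[of _ "p i"]) simp
  then show "j < inner_shape n p T i"
    using j tableau_row_mono[OF assms, of "inner_shape n p T i" j i] by (meson leI le_less_trans)
qed

text \<open>Column strictness: a cell above another one has a smaller entry than a number that is at
  most \<open>n\<close>, so it belongs to the inner shape.\<close>

lemma inner_shape_hstrip:
  assumes "T \<in> tableaux (Suc n) p" "p \<in> par" shows "hstrip (inner_shape n p T) p"
proof -
  have le: "a \<le> b \<longleftrightarrow> (\<forall>i<a. i < b)" for a b :: nat by (meson less_irrefl less_le_trans not_le)
  have "j < p i \<and> T (i, j) < n" if "j < p (Suc i)" for i j
  proof -
    have d: "(Suc i, j) \<in> diagram p" using that by (simp add: diagram_def)
    then have "T (Suc i, j) < Suc n" "T (i, j) < T (Suc i, j)" using assms(1) by (auto simp: tableaux_def)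
    then show ?thesis using that par_antimono[OF assms(2), of i "Suc i"] by simp
  qed
  then show ?thesis
    unfolding hstrip_def le using less_inner_shape_iff[OF assms(1)] by blast
qed

lemma inner_tableau_in:
  assumes "T \<in> tableaux (Suc n) p" "p \<in> par"
  shows "inner_tableau (inner_shape n p T) T \<in> tableaux n (inner_shape n p T)"
proof -
  let ?m = "inner_shape n p T"
  have d: "(i, j) \<in> diagram ?m \<longleftrightarrow> (i, j) \<in> diagram p \<and> T (i, j) < n" for i j
    using less_inner_shape_iff[OF assms(1)] by (simp add: diagram_def)
  have mp: "?m \<in> par" using inner_shape_hstrip[OF assms] assms(2) by (rule hstrip_par_inner)
  have l: "(i, j) \<in> diagram ?m" if "(i, Suc j) \<in> diagram ?m" for i j
    using that by (simp add: diagram_def)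
  have u: "(i, j) \<in> diagram ?m" if "(Suc i, j) \<in> diagram ?m" for i j
    using that par_antimono[OF mp, of i "Suc i"] by (simp add: diagram_def)
  have T: "\<And>i j. (i, Suc j) \<in> diagram p \<Longrightarrow> T (i, j) \<le> T (i, Suc j)"
    "\<And>i j. (Suc i, j) \<in> diagram p \<Longrightarrow> T (i, j) < T (Suc i, j)"
    using assms(1) by (auto simp: tableaux_def)
  show ?thesis unfolding tableaux_def mem_Collect_eq
  proof (intro conjI allI impI ballI)
    fix c assume "c \<notin> diagram ?m"
    then show "inner_tableau ?m T c = 0" by (simp add: inner_tableau_def)
  next
    fix c assume "c \<in> diagram ?m"
    then show "inner_tableau ?m T c < n" using d by (cases c) (simp add: inner_tableau_def)
  next
    fix i j assume "(i, Suc j) \<in> diagram ?m"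
    then show "inner_tableau ?m T (i, j) \<le> inner_tableau ?m T (i, Suc j)"
      using l[of i j] T(1)[of i j] d by (simp add: inner_tableau_def)
  next
    fix i j assume "(Suc i, j) \<in> diagram ?m"
    then show "inner_tableau ?m T (i, j) < inner_tableau ?m T (Suc i, j)"
      using u[of i j] T(2)[of i j] d by (simp add: inner_tableau_def)
  qed
qed

lemma diagram_mono: "hstrip \<mu> p \<Longrightarrow> diagram \<mu> \<subseteq> diagram p"
  using hstrip_le[of \<mu> p] by (auto simp: diagram_def intro: less_le_trans)

text \<open>The new entries \<open>n\<close> cannot break column strictness, because the cell above
  any cell of \<open>p\<close> lies in \<open>\<mu>\<close> and carries an entry below
  \<open>n\<close>.\<close>

lemma outer_tableau_in:
  assumes "hstrip \<mu> p" "p \<in> par" "T \<in> tableaux n \<mu>"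
  shows "outer_tableau n p \<mu> T \<in> tableaux (Suc n) p"
proof -
  have T: "\<And>i j. (i, Suc j) \<in> diagram \<mu> \<Longrightarrow> T (i, j) \<le> T (i, Suc j)"
    "\<And>i j. (Suc i, j) \<in> diagram \<mu> \<Longrightarrow> T (i, j) < T (Suc i, j)"
    "\<And>c. c \<in> diagram \<mu> \<Longrightarrow> T c < n"
    using assms(3) by (auto simp: tableaux_def)
  have l: "(i, j) \<in> diagram \<mu>" if "(i, Suc j) \<in> diagram \<mu>" for i j
    using that by (simp add: diagram_def)
  have lp: "(i, j) \<in> diagram p" if "(i, Suc j) \<in> diagram p" for i j
    using that by (simp add: diagram_def)
  have u: "(i, j) \<in> diagram \<mu>" if "(Suc i, j) \<in> diagram p" for i j
    using that hstrip_Suc_le[OF assms(1), of i] by (simp add: diagram_def)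
  note sub = diagram_mono[OF assms(1)]
  show ?thesis unfolding tableaux_def mem_Collect_eq
  proof (intro conjI allI impI ballI)
    fix c assume "c \<notin> diagram p"
    then show "outer_tableau n p \<mu> T c = 0" using sub by (auto simp: outer_tableau_def)
  next
    fix c assume "c \<in> diagram p"
    then show "outer_tableau n p \<mu> T c < Suc n" using T(3) by (simp add: outer_tableau_def less_SucI)
  next
    fix i j assume "(i, Suc j) \<in> diagram p"
    then show "outer_tableau n p \<mu> T (i, j) \<le> outer_tableau n p \<mu> T (i, Suc j)"
      using l[of i j] lp[of i j] T(1)[of i j] T(3)[of "(i, j)"] by (auto simp: outer_tableau_def)
  next
    fix i j assume "(Suc i, j) \<in> diagram p"
    then show "outer_tableau n p \<mu> T (i, j) < outer_tableau n p \<mu> T (Suc i, j)"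
      using u[of i j] T(2)[of i j] T(3)[of "(i, j)"] by (simp add: outer_tableau_def)
  qed
qed

lemma outer_inner_tableau:
  assumes "T \<in> tableaux (Suc n) p"
  shows "outer_tableau n p (inner_shape n p T) (inner_tableau (inner_shape n p T) T) = T"
proof
  fix c :: "nat \<times> nat"
  obtain i j where c: "c = (i, j)" by (cases c)
  have "T c < Suc n" if "c \<in> diagram p" using that assms by (simp add: tableaux_def)
  moreover have "T c = 0" if "c \<notin> diagram p" using that assms by (cases c) (simp add: tableaux_def)
  moreover have "c \<in> diagram (inner_shape n p T) \<longleftrightarrow> c \<in> diagram p \<and> T c < n"
    using less_inner_shape_iff[OF assms] by (simp add: c diagram_def)
  ultimately show "outer_tableau n p (inner_shape n p T) (inner_tableau (inner_shape n p T) T) c = T c"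
    by (auto simp: outer_tableau_def inner_tableau_def)
qed

lemma inner_outer_tableau:
  assumes "hstrip \<mu> p" "p \<in> par" "T \<in> tableaux n \<mu>"
  shows "inner_shape n p (outer_tableau n p \<mu> T) = \<mu>"
    and "inner_tableau \<mu> (outer_tableau n p \<mu> T) = T"
proof -
  have T: "T c < n" if "c \<in> diagram \<mu>" for c using assms(3) that by (cases c) (simp add: tableaux_def)
  have T0: "T c = 0" if "c \<notin> diagram \<mu>" for c using assms(3) that by (cases c) (simp add: tableaux_def)
  show "inner_shape n p (outer_tableau n p \<mu> T) = \<mu>"
  proof
    fix i
    have "j < inner_shape n p (outer_tableau n p \<mu> T) i \<longleftrightarrow> j < \<mu> i" for j
      unfolding less_inner_shape_iff[OF outer_tableau_in[OF assms]]
      using hstrip_le[OF assms(1), of i] T[of "(i, j)"] by (auto simp: outer_tableau_def diagram_def)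
    then show "inner_shape n p (outer_tableau n p \<mu> T) i = \<mu> i"
      by (metis less_irrefl linorder_neqE_nat)
  qed
  show "inner_tableau \<mu> (outer_tableau n p \<mu> T) = T"
    using T0 by (auto simp: inner_tableau_def outer_tableau_def fun_eq_iff)
qed

lemma weight_outer_tableau:
  assumes "hstrip \<mu> p" "p \<in> par"
  shows "weight p (outer_tableau n p \<mu> T) = xpow n (psize p - psize \<mu>) * weight \<mu> T"
proof -
  have mp: "\<mu> \<in> par" using assms hstrip_par_inner by blast
  note sub = diagram_mono[OF assms(1)]
  have const: "finite A \<Longrightarrow> (\<Sum>c\<in>A. Poly_Mapping.single n (1::nat)) = Poly_Mapping.single n (card A)" for A :: "(nat \<times> nat) set"
    by (induction A rule: finite_induct) (simp_all add: single_add[symmetric] del: sum_constant)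
  have "(\<Sum>c\<in>diagram p. Poly_Mapping.single (outer_tableau n p \<mu> T c) (1::nat))
    = (\<Sum>c\<in>diagram p - diagram \<mu>. Poly_Mapping.single (outer_tableau n p \<mu> T c) 1)
      + (\<Sum>c\<in>diagram \<mu>. Poly_Mapping.single (outer_tableau n p \<mu> T c) 1)"
    using sub diagram_finite_card(1)[OF assms(2)] by (rule sum.subset_diff)
  also have "(\<Sum>c\<in>diagram p - diagram \<mu>. Poly_Mapping.single (outer_tableau n p \<mu> T c) (1::nat))
    = (\<Sum>c\<in>diagram p - diagram \<mu>. Poly_Mapping.single n 1)"
    by (rule sum.cong) (auto simp: outer_tableau_def)
  also have "\<dots> = Poly_Mapping.single n (psize p - psize \<mu>)"
    using diagram_finite_card[OF assms(2)] diagram_finite_card[OF mp] sub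
    by (simp only: const finite_Diff card_Diff_subset)
  also have "(\<Sum>c\<in>diagram \<mu>. Poly_Mapping.single (outer_tableau n p \<mu> T c) (1::nat))
    = (\<Sum>c\<in>diagram \<mu>. Poly_Mapping.single (T c) 1)"
    by (rule sum.cong) (auto simp: outer_tableau_def)
  finally show ?thesis by (simp add: weight_def xpow_def mult_single)
qed

text \<open>Induction on \<open>n\<close>: a tableau corresponds to the pair of its inner shape and
  its inner tableau, and the removed cells contribute the power of the last variable in the
  recursion.\<close>

lemma gtschur_eq_tableaux_sum:
  assumes "p \<in> par" shows "gtschur n p = (\<Sum>T\<in>tableaux n p. weight p T)"
  using assms
proof (induction n arbitrary: p)
  case 0
  show ?case
  proof (cases "p = (\<lambda>_. 0)")
    case True
    then have d: "diagram p = {}" by (simp add: diagram_def)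
    then have "tableaux 0 p = {\<lambda>_. 0}" by (auto simp: tableaux_def)
    then show ?thesis using True d by (simp add: weight_def)
  next
    case False
    then obtain i where "0 < p i" by (metis gr0I ext)
    then have "(i, 0) \<in> diagram p" by (simp add: diagram_def)
    then have "tableaux 0 p = {}" unfolding tableaux_def by auto
    then show ?thesis using False by simp
  qed
next
  case (Suc n)
  let ?J = "Sigma {\<mu>. hstrip \<mu> p} (tableaux n)"
  have I: "\<mu> \<in> par" if "hstrip \<mu> p" for \<mu> using that Suc.prems hstrip_par_inner by blast
  have "gtschur (Suc n) p = (\<Sum>\<mu> | hstrip \<mu> p. \<Sum>T\<in>tableaux n \<mu>. xpow n (psize p - psize \<mu>) * weight \<mu> T)"
    using I by (simp add: Suc.IH sum_distrib_left)
  also have "\<dots> = (\<Sum>(\<mu>, T)\<in>?J. xpow n (psize p - psize \<mu>) * weight \<mu> T)"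
    using finite_hstrip_inner[OF Suc.prems] I by (intro sum.Sigma) (auto intro: finite_tableaux)
  also have "\<dots> = (\<Sum>T\<in>tableaux (Suc n) p. weight p T)"
    by (rule sum.reindex_bij_witness[where
        i = "\<lambda>T. (inner_shape n p T, inner_tableau (inner_shape n p T) T)" and
        j = "\<lambda>(\<mu>, T). outer_tableau n p \<mu> T"])
      (auto simp: Suc.prems inner_outer_tableau outer_inner_tableau outer_tableau_in inner_tableau_in
        inner_shape_hstrip weight_outer_tableau)
  finally show ?case .
qed

section \<open>The Pieri rules\<close>

text \<open>The common horizontal-strip extensions \<open>\<mu>\<close> of \<open>\<alpha>\<close> and \<open>\<nu>\<close> and their common horizontal-strip
  contractions \<open>\<kappa>\<close> are both described by letting \<open>\<mu> (Suc i)\<close>, respectively \<open>\<kappa> i\<close>, range over the same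
  interval from \<open>max (\<alpha> (Suc i)) (\<nu> (Suc i))\<close> to \<open>min (\<alpha> i) (\<nu> i)\<close>, with \<open>\<mu> 0\<close> bounded only from
  below. Reflecting each interval matches pairs \<open>(\<kappa>, j)\<close> with \<open>\<mu>\<close>, where \<open>j\<close> is the excess of \<open>\<mu> 0\<close>.\<close>

definition reflect_down :: "(nat \<Rightarrow> nat) \<Rightarrow> (nat \<Rightarrow> nat) \<Rightarrow> (nat \<Rightarrow> nat) \<Rightarrow> nat \<Rightarrow> nat" where
  "reflect_down \<alpha> \<nu> \<mu> i = max (\<alpha> (Suc i)) (\<nu> (Suc i)) + min (\<alpha> i) (\<nu> i) - \<mu> (Suc i)"

definition reflect_up :: "(nat \<Rightarrow> nat) \<Rightarrow> (nat \<Rightarrow> nat) \<Rightarrow> nat \<Rightarrow> (nat \<Rightarrow> nat) \<Rightarrow> nat \<Rightarrow> nat" where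
  "reflect_up \<alpha> \<nu> j \<kappa> i = (case i of 0 \<Rightarrow> max (\<alpha> 0) (\<nu> 0) + j
     | Suc i \<Rightarrow> max (\<alpha> (Suc i)) (\<nu> (Suc i)) + min (\<alpha> i) (\<nu> i) - \<kappa> i)"

lemma reflect_down_hstrip:
  assumes "hstrip \<alpha> \<mu>" "hstrip \<nu> \<mu>"
  shows "hstrip (reflect_down \<alpha> \<nu> \<mu>) \<alpha>" "hstrip (reflect_down \<alpha> \<nu> \<mu>) \<nu>"
proof -
  have k: "max (\<alpha> (Suc i)) (\<nu> (Suc i)) \<le> \<mu> (Suc i) \<and> \<mu> (Suc i) \<le> min (\<alpha> i) (\<nu> i)" for i
    using assms by (simp add: hstrip_def)
  have "max (\<alpha> (Suc i)) (\<nu> (Suc i)) \<le> reflect_down \<alpha> \<nu> \<mu> i \<and> reflect_down \<alpha> \<nu> \<mu> i \<le> min (\<alpha> i) (\<nu> i)" for i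
    unfolding reflect_down_def using k[of i] by linarith
  then show "hstrip (reflect_down \<alpha> \<nu> \<mu>) \<alpha>" "hstrip (reflect_down \<alpha> \<nu> \<mu>) \<nu>"
    by (simp_all add: hstrip_def)
qed

lemma reflect_up_hstrip:
  assumes "hstrip \<kappa> \<alpha>" "hstrip \<kappa> \<nu>"
  shows "hstrip \<alpha> (reflect_up \<alpha> \<nu> j \<kappa>)" "hstrip \<nu> (reflect_up \<alpha> \<nu> j \<kappa>)"
proof -
  let ?\<mu> = "reflect_up \<alpha> \<nu> j \<kappa>"
  have k: "max (\<alpha> (Suc i)) (\<nu> (Suc i)) \<le> \<kappa> i \<and> \<kappa> i \<le> min (\<alpha> i) (\<nu> i)" for i
    using assms by (simp add: hstrip_def)
  have s: "max (\<alpha> (Suc i)) (\<nu> (Suc i)) \<le> ?\<mu> (Suc i) \<and> ?\<mu> (Suc i) \<le> min (\<alpha> i) (\<nu> i)" for i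
    unfolding reflect_up_def using k[of i] by (simp only: nat.case) linarith
  moreover have "max (\<alpha> 0) (\<nu> 0) \<le> ?\<mu> 0" by (simp add: reflect_up_def)
  ultimately have "max (\<alpha> i) (\<nu> i) \<le> ?\<mu> i" for i by (cases i) blast+
  with s show "hstrip \<alpha> ?\<mu>" "hstrip \<nu> ?\<mu>"
    by (simp_all add: hstrip_def)
qed

lemma reflect_up_down:
  assumes "hstrip \<alpha> \<mu>" "hstrip \<nu> \<mu>"
  shows "reflect_up \<alpha> \<nu> (\<mu> 0 - max (\<alpha> 0) (\<nu> 0)) (reflect_down \<alpha> \<nu> \<mu>) = \<mu>"
proof
  fix i
  have k: "max (\<alpha> i) (\<nu> i) \<le> \<mu> i \<and> \<mu> (Suc i) \<le> min (\<alpha> i) (\<nu> i)" for i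
    using assms by (simp add: hstrip_def)
  show "reflect_up \<alpha> \<nu> (\<mu> 0 - max (\<alpha> 0) (\<nu> 0)) (reflect_down \<alpha> \<nu> \<mu>) i = \<mu> i"
  proof (cases i)
    case 0 then show ?thesis using k[of 0] by (simp add: reflect_up_def)
  next
    case (Suc j)
    have "\<mu> (Suc j) \<le> max (\<alpha> (Suc j)) (\<nu> (Suc j)) + min (\<alpha> j) (\<nu> j)" using k[of j] by linarith
    then show ?thesis by (simp add: Suc reflect_up_def reflect_down_def)
  qed
qed

lemma reflect_down_up:
  assumes "hstrip \<kappa> \<alpha>" "hstrip \<kappa> \<nu>"
  shows "reflect_down \<alpha> \<nu> (reflect_up \<alpha> \<nu> j \<kappa>) = \<kappa>"
proof
  fix i
  have "\<kappa> i \<le> min (\<alpha> i) (\<nu> i)" using assms by (simp add: hstrip_def)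
  then have "\<kappa> i \<le> max (\<alpha> (Suc i)) (\<nu> (Suc i)) + min (\<alpha> i) (\<nu> i)" by linarith
  then show "reflect_down \<alpha> \<nu> (reflect_up \<alpha> \<nu> j \<kappa>) i = \<kappa> i"
    by (simp add: reflect_up_def reflect_down_def)
qed

text \<open>Row \<open>Suc i\<close> of the reflected sequence and row \<open>i\<close> of
  \<open>\<kappa>\<close> add up to a maximum at \<open>Suc i\<close> plus a minimum at
  \<open>i\<close>. After shifting the index of the maxima, maximum and minimum in the same row add
  up to \<open>\<alpha> i + \<nu> i\<close>, and only the excess \<open>j\<close> remains.\<close>

lemma psize_reflect_up:
  assumes "\<alpha> \<in> par" "\<nu> \<in> par" "hstrip \<kappa> \<alpha>" "hstrip \<kappa> \<nu>"
  shows "psize (reflect_up \<alpha> \<nu> j \<kappa>) + psize \<kappa> = psize \<alpha> + psize \<nu> + j"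
proof -
  let ?\<mu> = "reflect_up \<alpha> \<nu> j \<kappa>"
  obtain m1 where m1: "\<forall>i\<ge>m1. \<alpha> i = 0" using par_bound[OF assms(1)] by blast
  obtain m2 where m2: "\<forall>i\<ge>m2. \<nu> i = 0" using par_bound[OF assms(2)] by blast
  define m where "m = max m1 m2"
  have a: "\<forall>i\<ge>m. \<alpha> i = 0" and n: "\<forall>i\<ge>m. \<nu> i = 0" using m1 m2 by (auto simp: m_def)
  have k: "\<kappa> i \<le> min (\<alpha> i) (\<nu> i)" for i using assms by (simp add: hstrip_def)
  have kz: "\<forall>i\<ge>m. \<kappa> i = 0"
  proof (intro allI impI)
    fix i assume "m \<le> i"
    then show "\<kappa> i = 0" using k[of i] a by simp
  qed
  \<comment> \<open>One row more than for \<open>\<alpha>\<close> and \<open>\<nu>\<close>: row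
    \<open>Suc i\<close> is governed by row \<open>i\<close> of the two.\<close>
  have mz: "\<forall>i\<ge>Suc m. ?\<mu> i = 0"
  proof (intro allI impI)
    fix i assume "Suc m \<le> i"
    then obtain l where "i = Suc l" "m \<le> l" by (cases i) auto
    then show "?\<mu> i = 0" using a n by (simp add: reflect_up_def)
  qed
  have s: "?\<mu> (Suc i) + \<kappa> i = max (\<alpha> (Suc i)) (\<nu> (Suc i)) + min (\<alpha> i) (\<nu> i)" for i
    unfolding reflect_up_def using k[of i] by (simp only: nat.case)
  have "psize ?\<mu> + psize \<kappa> = ?\<mu> 0 + (\<Sum>i<m. ?\<mu> (Suc i) + \<kappa> i)"
    using psize_eq_sum[OF mz] psize_eq_sum[OF kz] by (simp add: sum.lessThan_Suc_shift sum.distrib del: sum.lessThan_Suc)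
  also have "\<dots> = j + (max (\<alpha> 0) (\<nu> 0) + (\<Sum>i<m. max (\<alpha> (Suc i)) (\<nu> (Suc i)))) + (\<Sum>i<m. min (\<alpha> i) (\<nu> i))"
    by (simp add: s sum.distrib) (simp add: reflect_up_def)
  also have "max (\<alpha> 0) (\<nu> 0) + (\<Sum>i<m. max (\<alpha> (Suc i)) (\<nu> (Suc i))) = (\<Sum>i<Suc m. max (\<alpha> i) (\<nu> i))"
    by (rule sum.lessThan_Suc_shift[symmetric])
  also have "\<dots> = (\<Sum>i<m. max (\<alpha> i) (\<nu> i))" using a n by simp
  also have "j + \<dots> + (\<Sum>i<m. min (\<alpha> i) (\<nu> i)) = j + (\<Sum>i<m. max (\<alpha> i) (\<nu> i) + min (\<alpha> i) (\<nu> i))"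
    by (simp add: sum.distrib)
  also have "(\<Sum>i<m. max (\<alpha> i) (\<nu> i) + min (\<alpha> i) (\<nu> i)) = (\<Sum>i<m. \<alpha> i + \<nu> i)"
    by (rule sum.cong) auto
  finally show ?thesis using psize_eq_sum[OF a] psize_eq_sum[OF n] by (simp add: sum.distrib)
qed

lemma psize_reflect_down:
  assumes "\<alpha> \<in> par" "hstrip \<alpha> \<mu>" "hstrip \<nu> \<mu>"
  shows "psize \<mu> + psize (reflect_down \<alpha> \<nu> \<mu>) = psize \<alpha> + psize \<nu> + (\<mu> 0 - max (\<alpha> 0) (\<nu> 0))"
proof -
  have "\<nu> \<in> par" using assms hstrip_par_inner hstrip_par_outer by blast
  then show ?thesis
    using psize_reflect_up[OF assms(1) _ reflect_down_hstrip[OF assms(2,3)], of "\<mu> 0 - max (\<alpha> 0) (\<nu> 0)"]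
    by (simp add: reflect_up_down[OF assms(2,3)])
qed

text \<open>The complete homogeneous polynomial \<open>h_k\<close>, split by the exponent of the
  last variable to match the recursion of \<open>gtschur\<close>.\<close>

primrec complete :: "nat \<Rightarrow> nat \<Rightarrow> mpoly" where
  "complete 0 k = (if k = 0 then 1 else 0)"
| "complete (Suc n) k = (\<Sum>j\<le>k. xpow n j * complete n (k - j))"

text \<open>Induction on \<open>n\<close>. Expanding the left side in the last variable and applying
  the induction hypothesis yields triples: \<open>\<alpha>\<close> is peeled to
  \<open>\<kappa>\<close>, the exponent \<open>j\<close> comes from \<open>h_k\<close>, and a strip
  of size \<open>k - j\<close> leads from \<open>\<kappa>\<close> to \<open>\<nu>\<close>. The right
  side yields pairs of \<open>\<mu>\<close> and its peeled \<open>\<nu>\<close>. For fixed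
  \<open>\<nu>\<close> the reflection matches the two and preserves the exponent of the last
  variable.\<close>

lemma pieri_complete:
  assumes "\<alpha> \<in> par"
  shows "complete n k * gtschur n \<alpha> = (\<Sum>\<mu>\<in>hstrips \<alpha> k. gtschur n \<mu>)"
  using assms
proof (induction n arbitrary: \<alpha> k)
  case 0
  have z: "(\<lambda>_. 0) \<in> hstrips \<alpha> k \<longleftrightarrow> \<alpha> = (\<lambda>_. 0) \<and> k = 0"
    using 0 by (auto simp: hstrips_def hstrip_def psize_zero_iff)
  have "(\<Sum>\<mu>\<in>hstrips \<alpha> k. gtschur 0 \<mu>) = (if (\<lambda>_. 0) \<in> hstrips \<alpha> k then 1 else 0)"
    using finite_hstrips[OF 0] by simp
  then show ?case by (simp add: z)
next
  case (Suc n)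
  let ?I = "{\<kappa>. hstrip \<kappa> \<alpha>}"
  let ?J = "Sigma (hstrips \<alpha> k) (\<lambda>\<mu>. {\<nu>. hstrip \<nu> \<mu>})"
  let ?K = "Sigma ?I (\<lambda>\<kappa>. Sigma {..k} (\<lambda>j. hstrips \<kappa> (k - j)))"
  have I: "\<kappa> \<in> par" if "hstrip \<kappa> \<alpha>" for \<kappa> using that Suc.prems hstrip_par_inner by blast
  have P: "\<mu> \<in> par" if "\<mu> \<in> hstrips \<alpha> k" for \<mu>
    using that Suc.prems hstrip_par_outer by (auto simp: hstrips_def)
  have finI: "finite ?I" using Suc.prems by (rule finite_hstrip_inner)
  have "complete (Suc n) k * gtschur (Suc n) \<alpha>
    = (\<Sum>j\<le>k. xpow n j * complete n (k - j)) * (\<Sum>\<kappa>\<in>?I. xpow n (psize \<alpha> - psize \<kappa>) * gtschur n \<kappa>)"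
    by simp
  also have "\<dots> = (\<Sum>\<kappa>\<in>?I. \<Sum>j\<le>k. xpow n (j + (psize \<alpha> - psize \<kappa>)) * (complete n (k - j) * gtschur n \<kappa>))"
    by (subst sum.swap) (simp add: sum_product xpow_add mult_ac)
  also have "\<dots> = (\<Sum>\<kappa>\<in>?I. \<Sum>j\<le>k. \<Sum>\<nu>\<in>hstrips \<kappa> (k - j). xpow n (j + (psize \<alpha> - psize \<kappa>)) * gtschur n \<nu>)"
    using I by (intro sum.cong refl) (simp add: Suc.IH sum_distrib_left)
  also have "\<dots> = (\<Sum>(\<kappa>, j, \<nu>)\<in>?K. xpow n (j + (psize \<alpha> - psize \<kappa>)) * gtschur n \<nu>)"
  proof -
    have "(\<Sum>\<kappa>\<in>?I. \<Sum>j\<le>k. \<Sum>\<nu>\<in>hstrips \<kappa> (k - j). xpow n (j + (psize \<alpha> - psize \<kappa>)) * gtschur n \<nu>)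
      = (\<Sum>\<kappa>\<in>?I. \<Sum>(j, \<nu>)\<in>Sigma {..k} (\<lambda>j. hstrips \<kappa> (k - j)). xpow n (j + (psize \<alpha> - psize \<kappa>)) * gtschur n \<nu>)"
      using I by (intro sum.cong refl sum.Sigma) (auto intro: finite_hstrips)
    also have "\<dots> = (\<Sum>(\<kappa>, j, \<nu>)\<in>?K. xpow n (j + (psize \<alpha> - psize \<kappa>)) * gtschur n \<nu>)"
      using finI I by (intro sum.Sigma) (auto intro: finite_hstrips)
    finally show ?thesis .
  qed
  also have "\<dots> = (\<Sum>(\<mu>, \<nu>)\<in>?J. xpow n (psize \<mu> - psize \<nu>) * gtschur n \<nu>)"
  proof (rule sum.reindex_bij_witness[where
        i = "\<lambda>(\<mu>, \<nu>). (reflect_down \<alpha> \<nu> \<mu>, \<mu> 0 - max (\<alpha> 0) (\<nu> 0), \<nu>)" and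
        j = "\<lambda>(\<kappa>, j, \<nu>). (reflect_up \<alpha> \<nu> j \<kappa>, \<nu>)"], goal_cases)
    case (1 a)
    then show ?case
      by (auto simp: reflect_down_up hstrips_def) (simp add: reflect_up_def)
  next
    case (2 a)
    then obtain \<kappa> j \<nu> where a: "a = (\<kappa>, j, \<nu>)" and h: "hstrip \<kappa> \<alpha>" "hstrip \<kappa> \<nu>"
      and s: "psize \<nu> = psize \<kappa> + (k - j)" "j \<le> k" by (auto simp: hstrips_def)
    have "\<nu> \<in> par" using h I hstrip_par_outer by blast
    then show ?case using reflect_up_hstrip[OF h, of j] psize_reflect_up[OF Suc.prems _ h, of j] s
      by (simp add: a hstrips_def)
  next
    case (3 b)
    then show ?case by (auto simp: hstrips_def reflect_up_down)
  next
    case (4 b)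
    then obtain \<mu> \<nu> where b: "b = (\<mu>, \<nu>)" and h: "hstrip \<alpha> \<mu>" "hstrip \<nu> \<mu>"
      and s: "psize \<mu> = psize \<alpha> + k" by (auto simp: hstrips_def)
    note r = reflect_down_hstrip[OF h]
    have "\<nu> \<in> par" using h Suc.prems hstrip_par_inner hstrip_par_outer by blast
    \<comment> \<open>This inequality turns the size identity into \<open>j \<le> k\<close> for the
      excess \<open>j\<close>, and so keeps the subtraction \<open>k - j\<close> exact.\<close>
    then have "psize (reflect_down \<alpha> \<nu> \<mu>) \<le> psize \<nu>" using r(2) hstrip_psize by blast
    then show ?case using r psize_reflect_down[OF Suc.prems h] s
      by (simp add: b hstrips_def)
  next
    case (5 a)
    then obtain \<kappa> j \<nu> where a: "a = (\<kappa>, j, \<nu>)" and h: "hstrip \<kappa> \<alpha>" "hstrip \<kappa> \<nu>"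
      by (auto simp: hstrips_def)
    have "\<nu> \<in> par" using h I hstrip_par_outer by blast
    moreover have "psize \<kappa> \<le> psize \<alpha>" using h Suc.prems hstrip_psize by blast
    ultimately have "psize (reflect_up \<alpha> \<nu> j \<kappa>) - psize \<nu> = j + (psize \<alpha> - psize \<kappa>)"
      using psize_reflect_up[OF Suc.prems _ h, of j] by simp
    then show ?case by (simp add: a)
  qed
  also have "\<dots> = (\<Sum>\<mu>\<in>hstrips \<alpha> k. gtschur (Suc n) \<mu>)"
    using P Suc.prems by (subst sum.Sigma[symmetric]) (auto simp: finite_hstrips finite_hstrip_inner)
  finally show ?case .
qed

section \<open>Vertical strips and the Pieri rule for elementary symmetric polynomials\<close>

definition vstrip :: "(nat \<Rightarrow> nat) \<Rightarrow> (nat \<Rightarrow> nat) \<Rightarrow> bool" where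
  "vstrip \<alpha> \<rho> \<longleftrightarrow> (\<forall>i. \<alpha> i \<le> \<rho> i \<and> \<rho> i \<le> Suc (\<alpha> i))"

text \<open>Membership in \<open>par\<close> is demanded explicitly: unlike \<open>hstrip\<close>,
  \<open>vstrip\<close> does not transfer it from \<open>\<alpha>\<close> to
  \<open>\<rho>\<close>.\<close>

definition vstrips :: "(nat \<Rightarrow> nat) \<Rightarrow> nat \<Rightarrow> (nat \<Rightarrow> nat) set" where
  "vstrips \<alpha> k = {\<rho> \<in> par. vstrip \<alpha> \<rho> \<and> psize \<rho> = psize \<alpha> + k}"

definition column :: "nat \<Rightarrow> nat \<Rightarrow> nat" where
  "column k i = (if i < k then 1 else 0)"

text \<open>The elementary symmetric polynomial \<open>e_k\<close>, as the Schur polynomial of a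
  single column.\<close>

definition elementary :: "nat \<Rightarrow> nat \<Rightarrow> mpoly" where
  "elementary n k = gtschur n (column k)"

lemma finite_vstrips: "finite (vstrips \<alpha> k)"
  by (rule finite_subset[OF _ finite_parts[of "psize \<alpha> + k"]]) (auto simp: vstrips_def parts_def)

lemma psize_update:
  assumes "p \<in> par" shows "psize (p(i := v)) + p i = psize p + v"
proof -
  obtain m0 where m0: "\<forall>i\<ge>m0. p i = 0" using par_bound[OF assms] by blast
  define m where "m = max m0 (Suc i)"
  have m: "\<forall>i\<ge>m. p i = 0" "i < m" using m0 by (auto simp: m_def)
  then have "\<forall>j\<ge>m. (p(i := v)) j = 0" by auto
  then have "psize (p(i := v)) = (\<Sum>j<m. (p(i := v)) j)" by (rule psize_eq_sum)
  also have "\<dots> = v + (\<Sum>j\<in>{..<m} - {i}. p j)"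
    using m by (simp add: sum.remove[of "{..<m}" i])
  finally show ?thesis
    using psize_eq_sum[OF m(1)] m(2) by (simp add: sum.remove[of "{..<m}" i])
qed

text \<open>The left side is the coefficient of the Schur polynomial of \<open>\<mu>\<close> when
  the alternating sum of \<open>h_(k-j) e_j\<close>, which vanishes for positive \<open>k\<close>,
  acts on that of \<open>\<alpha>\<close> through both kinds of strips.\<close>

lemma alternating_strips_zero:
  assumes "\<alpha> \<in> par" "\<mu> \<in> par" "psize \<alpha> < psize \<mu>"
  shows "(\<Sum>\<rho> | vstrip \<alpha> \<rho> \<and> hstrip \<rho> \<mu>. (-1) ^ (psize \<rho> - psize \<alpha>)) = (0::int)"
proof (cases "{\<rho>. vstrip \<alpha> \<rho> \<and> hstrip \<rho> \<mu>} = {}")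
  case False
  let ?C = "{\<rho>. vstrip \<alpha> \<rho> \<and> hstrip \<rho> \<mu>}"
  have le: "\<alpha> i \<le> \<mu> i" for i
  proof -
    obtain \<rho> where "vstrip \<alpha> \<rho>" "hstrip \<rho> \<mu>" using False by blast
    then have "\<alpha> i \<le> \<rho> i" "\<rho> i \<le> \<mu> i" by (auto simp: vstrip_def hstrip_def)
    then show ?thesis by simp
  qed
  define D where "D = {i. \<alpha> i < \<mu> i}"
  obtain m where m: "\<forall>i\<ge>m. \<mu> i = 0" using par_bound[OF assms(2)] by blast
  then have "D \<subseteq> {..<m}" unfolding D_def by (auto simp: not_le[symmetric] simp del: not_le)
  then have "finite D" using finite_subset by blast
  moreover have "D \<noteq> {}"
  proof
    assume "D = {}"
    then have "\<mu> i \<le> \<alpha> i" for i by (auto simp: D_def not_less)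
    then show False using psize_mono[OF assms(1), of \<mu>] assms(3) by simp
  qed
  ultimately have maxD: "Max D \<in> D" "\<And>i. i \<in> D \<Longrightarrow> i \<le> Max D" by auto
  define b where "b = Max D"
  have b: "\<alpha> b < \<mu> b" using maxD by (simp add: b_def D_def)
  \<comment> \<open>Below row \<open>b\<close> the sequence \<open>\<mu>\<close> no longer exceeds
    \<open>\<alpha>\<close>, so lowering \<open>\<rho> b\<close> to \<open>\<alpha> b\<close>
    respects interlacing with row \<open>Suc b\<close> of \<open>\<mu>\<close>.\<close>
  have "Suc b \<notin> D" using maxD(2) unfolding b_def by fastforce
  then have b': "\<mu> (Suc b) \<le> \<alpha> b"
    using par_antimono[OF assms(1), of b "Suc b"] by (simp add: D_def)
  \<comment> \<open>In the lowest row \<open>b\<close> where \<open>\<mu>\<close> exceeds \<open>\<alpha>\<close>, both values \<open>\<alpha> b\<close> and \<open>\<alpha> b + 1\<close> are admissible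
    for \<open>\<rho> b\<close>; exchanging them is a sign-reversing involution.\<close>
  define t where "t = (\<lambda>\<rho> :: nat \<Rightarrow> nat. \<rho>(b := 2 * \<alpha> b + 1 - \<rho> b))"
  have t: "t \<rho> \<in> ?C" "t (t \<rho>) = \<rho>"
    "(-1 :: int) ^ (psize (t \<rho>) - psize \<alpha>) = - ((-1) ^ (psize \<rho> - psize \<alpha>))" if "\<rho> \<in> ?C" for \<rho>
  proof -
    have v: "\<alpha> i \<le> \<rho> i" "\<rho> i \<le> Suc (\<alpha> i)" for i using that by (auto simp: vstrip_def)
    have h: "hstrip \<rho> \<mu>" using that by simp
    have tb: "\<alpha> b \<le> t \<rho> b" "t \<rho> b \<le> Suc (\<alpha> b)"
      using v(1)[of b] v(2)[of b] unfolding t_def fun_upd_apply by auto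
    have other: "t \<rho> i = \<rho> i" if "i \<noteq> b" for i using that by (simp add: t_def)
    have "vstrip \<alpha> (t \<rho>)" using tb other v unfolding vstrip_def by metis
    moreover have "t \<rho> i \<le> \<mu> i \<and> \<mu> (Suc i) \<le> t \<rho> i" for i
      using tb b b' other[of i] hstrip_le[OF h, of i] hstrip_Suc_le[OF h, of i]
      by (cases "i = b") auto
    then have "hstrip (t \<rho>) \<mu>" unfolding hstrip_def by blast
    with calculation show C: "t \<rho> \<in> ?C" by simp
    show "t (t \<rho>) = \<rho>" using v[of b] by (auto simp: t_def)
    have rp: "\<rho> \<in> par" using h assms(2) hstrip_par_inner by blast
    have tp: "t \<rho> \<in> par" using C assms(2) hstrip_par_inner by blast
    have u: "psize (t \<rho>) + \<rho> b = psize \<rho> + (2 * \<alpha> b + 1 - \<rho> b)"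
      unfolding t_def by (rule psize_update[OF rp])
    have "psize \<alpha> \<le> psize \<rho>" by (rule psize_mono[OF rp]) (rule v(1))
    moreover have "psize \<alpha> \<le> psize (t \<rho>)"
      using C by (intro psize_mono[OF tp]) (auto simp: vstrip_def)
    moreover have "\<rho> b = \<alpha> b \<or> \<rho> b = Suc (\<alpha> b)" using v[of b] by linarith
    ultimately have "psize (t \<rho>) - psize \<alpha> = Suc (psize \<rho> - psize \<alpha>)
        \<or> psize \<rho> - psize \<alpha> = Suc (psize (t \<rho>) - psize \<alpha>)"
      using u by auto
    then show "(-1 :: int) ^ (psize (t \<rho>) - psize \<alpha>) = - ((-1) ^ (psize \<rho> - psize \<alpha>))"
      by auto
  qed
  have "(\<Sum>\<rho>\<in>?C. (-1 :: int) ^ (psize \<rho> - psize \<alpha>)) = (\<Sum>\<rho>\<in>?C. - ((-1) ^ (psize \<rho> - psize \<alpha>)))"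
    by (rule sum.reindex_bij_witness[of _ t t]) (use t in auto)
  then show ?thesis by (simp add: sum_negf)
qed (simp only: sum.empty)

text \<open>The sum over \<open>vstrips\<close> stands in place of \<open>e_j\<close> times the
  Schur polynomial, since this identity is the source of the Pieri rule for \<open>e_j\<close>.
  Adding a vertical and then a horizontal strip and grouping by the final shape reduces it to the
  signed count above.\<close>

lemma alternating_pieri:
  assumes "\<alpha> \<in> par" "0 < k"
  shows "(\<Sum>j\<le>k. (-1) ^ j * (complete n (k - j) * (\<Sum>\<rho>\<in>vstrips \<alpha> j. gtschur n \<rho>))) = 0"
proof -
  let ?C = "\<lambda>\<mu>. {\<rho>. vstrip \<alpha> \<rho> \<and> hstrip \<rho> \<mu>}"
  let ?K = "Sigma {..k} (\<lambda>j. Sigma (vstrips \<alpha> j) (\<lambda>\<rho>. hstrips \<rho> (k - j)))"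
  let ?J = "Sigma (parts (psize \<alpha> + k)) ?C"
  have vp: "\<rho> \<in> par" if "\<rho> \<in> vstrips \<alpha> j" for \<rho> j using that by (simp add: vstrips_def)
  have "(\<Sum>j\<le>k. (-1) ^ j * (complete n (k - j) * (\<Sum>\<rho>\<in>vstrips \<alpha> j. gtschur n \<rho>)))
    = (\<Sum>j\<le>k. \<Sum>\<rho>\<in>vstrips \<alpha> j. \<Sum>\<mu>\<in>hstrips \<rho> (k - j). (-1) ^ j * gtschur n \<mu>)"
    by (simp add: sum_distrib_left pieri_complete[OF vp])
  also have "\<dots> = (\<Sum>j\<le>k. \<Sum>(\<rho>, \<mu>)\<in>Sigma (vstrips \<alpha> j) (\<lambda>\<rho>. hstrips \<rho> (k - j)). (-1) ^ j * gtschur n \<mu>)"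
    by (intro sum.cong refl sum.Sigma) (auto intro: finite_hstrips finite_vstrips vp)
  also have "\<dots> = (\<Sum>(j, \<rho>, \<mu>)\<in>?K. (-1) ^ j * gtschur n \<mu>)"
    by (intro sum.Sigma) (auto intro: finite_hstrips finite_vstrips vp)
  also have "\<dots> = (\<Sum>(\<mu>, \<rho>)\<in>?J. (-1) ^ (psize \<rho> - psize \<alpha>) * gtschur n \<mu>)"
  proof (rule sum.reindex_bij_witness[where
        i = "\<lambda>(\<mu>, \<rho>). (psize \<rho> - psize \<alpha>, \<rho>, \<mu>)" and j = "\<lambda>(j, \<rho>, \<mu>). (\<mu>, \<rho>)"], goal_cases)
    case (4 b)
    then obtain \<mu> \<rho> where b: "b = (\<mu>, \<rho>)" and m: "\<mu> \<in> par" "psize \<mu> = psize \<alpha> + k"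
      and v: "vstrip \<alpha> \<rho>" and h: "hstrip \<rho> \<mu>" by (auto simp: parts_def)
    have r: "\<rho> \<in> par" using h m hstrip_par_inner by blast
    have "psize \<alpha> \<le> psize \<rho>" using v by (intro psize_mono[OF r]) (simp add: vstrip_def)
    moreover have "psize \<rho> \<le> psize \<mu>" using h m hstrip_psize by blast
    ultimately show ?case using r m v h by (simp add: b vstrips_def hstrips_def)
  qed (auto simp: vstrips_def hstrips_def parts_def intro: hstrip_par_outer)
  also have "\<dots> = (\<Sum>\<mu>\<in>parts (psize \<alpha> + k). \<Sum>\<rho>\<in>?C \<mu>. (-1) ^ (psize \<rho> - psize \<alpha>) * gtschur n \<mu>)"
  proof (rule sum.Sigma[symmetric])
    show "\<forall>\<mu>\<in>parts (psize \<alpha> + k). finite (?C \<mu>)"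
      by (auto simp: parts_def intro: rev_finite_subset[OF finite_hstrip_inner])
  qed simp
  also have "\<dots> = (\<Sum>\<mu>\<in>parts (psize \<alpha> + k). of_int (\<Sum>\<rho>\<in>?C \<mu>. (-1) ^ (psize \<rho> - psize \<alpha>)) * gtschur n \<mu>)"
    by (simp add: sum_distrib_right)
  also have "\<dots> = 0"
    using alternating_strips_zero[OF assms(1)] assms(2)
    by (intro sum.neutral ballI) (simp add: parts_def)
  finally show ?thesis .
qed

lemma column_par [simp]: "column k \<in> par"
  by (rule parI[of _ k]) (auto simp: column_def)

lemma psize_column [simp]: "psize (column k) = k"
  by (subst psize_eq_sum[of k]) (auto simp: column_def)

lemma vstrips_zero: "vstrips (\<lambda>_. 0) k = {column k}"
proof -
  have "\<rho> = column k" if "\<rho> \<in> vstrips (\<lambda>_. 0) k" for \<rho>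
  proof
    fix i
    have r: "\<rho> \<in> par" "psize \<rho> = k" and le: "\<And>i. \<rho> i \<le> 1"
      using that by (auto simp: vstrips_def vstrip_def)
    define c where "c = (LEAST i. \<rho> i = 0)"
    have ex: "\<exists>i. \<rho> i = 0" using par_bound[OF r(1)] by blast
    then have "\<rho> c = 0" unfolding c_def by (rule LeastI_ex)
    then have z: "\<rho> i = 0" if "c \<le> i" for i using that r(1) par_zeroD by blast
    have nz: "\<rho> i = 1" if "i < c" for i
      using not_less_Least[of i "\<lambda>i. \<rho> i = 0"] that le[of i] unfolding c_def by simp
    then have "\<rho> = column c" using z by (auto simp: column_def fun_eq_iff)
    then show "\<rho> i = column k i" using r(2) by simp
  qed
  moreover have "column k \<in> vstrips (\<lambda>_. 0) k"
    by (simp add: vstrips_def vstrip_def column_def[abs_def]) (simp add: column_def[symmetric])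
  ultimately show ?thesis by blast
qed

text \<open>Strong induction on \<open>k\<close>: the alternating identity determines its term for
  \<open>j = k\<close> from the smaller ones, and by induction these have the form of a fixed factor
  times \<open>gtschur n \<beta>\<close>. The factor is the same for every \<open>\<beta>\<close>,
  so it can be computed from the empty partition.\<close>

lemma pieri_elementary:
  assumes "\<alpha> \<in> par"
  shows "elementary n k * gtschur n \<alpha> = (\<Sum>\<rho>\<in>vstrips \<alpha> k. gtschur n \<rho>)"
  using assms
proof (induction k arbitrary: \<alpha> rule: less_induct)
  case (less k)
  show ?case
  proof (cases "k = 0")
    case True
    have "vstrips \<alpha> 0 = {\<alpha>}"
    proof -
      have "\<rho> = \<alpha>" if "\<rho> \<in> vstrips \<alpha> 0" for \<rho>
        using that psize_eq_imp_eq[of \<rho> \<alpha>] by (auto simp: vstrips_def vstrip_def)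
      then show ?thesis using less.prems by (auto simp: vstrips_def vstrip_def)
    qed
    moreover have "column 0 = (\<lambda>_. 0)" by (auto simp: column_def)
    ultimately show ?thesis using True by (simp add: elementary_def)
  next
    case False
    have expand: "(-1) ^ k * (\<Sum>\<rho>\<in>vstrips \<beta> k. gtschur n \<rho>)
      = - (\<Sum>j<k. (-1) ^ j * (complete n (k - j) * elementary n j)) * gtschur n \<beta>" if "\<beta> \<in> par" for \<beta>
    proof -
      have one: "complete n 0 = 1" by (induction n) auto
      have "{..k} = insert k {..<k}" by auto
      then have "(-1) ^ k * (\<Sum>\<rho>\<in>vstrips \<beta> k. gtschur n \<rho>)
        + (\<Sum>j<k. (-1) ^ j * (complete n (k - j) * (\<Sum>\<rho>\<in>vstrips \<beta> j. gtschur n \<rho>))) = 0"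
        using alternating_pieri[OF that, of k n] False by (simp add: one)
      moreover have "(\<Sum>j<k. (-1) ^ j * (complete n (k - j) * (\<Sum>\<rho>\<in>vstrips \<beta> j. gtschur n \<rho>)))
        = (\<Sum>j<k. (-1) ^ j * (complete n (k - j) * elementary n j)) * gtschur n \<beta>"
        unfolding sum_distrib_right
        by (intro sum.cong refl) (simp add: less.IH[OF _ that, symmetric] mult_ac)
      ultimately show ?thesis by (simp add: eq_neg_iff_add_eq_0)
    qed
    \<comment> \<open>For the empty partition the only vertical strip of size \<open>k\<close> is
      the column, which identifies the common factor as \<open>e_k\<close> up to sign.\<close>
    have "(-1) ^ k * elementary n k = - (\<Sum>j<k. (-1) ^ j * (complete n (k - j) * elementary n j))"
      using expand[of "\<lambda>_. 0"] by (simp add: vstrips_zero elementary_def)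
    then have "(-1) ^ k * (\<Sum>\<rho>\<in>vstrips \<alpha> k. gtschur n \<rho>) = (-1) ^ k * elementary n k * gtschur n \<alpha>"
      using expand[OF less.prems] by simp
    then have "(-1) ^ k * ((-1) ^ k * (\<Sum>\<rho>\<in>vstrips \<alpha> k. gtschur n \<rho>))
        = (-1) ^ k * ((-1) ^ k * (elementary n k * gtschur n \<alpha>))"
      by (simp add: mult.assoc)
    then show ?thesis by (simp add: mult.assoc[symmetric] power_add[symmetric] mult_2[symmetric])
  qed
qed

section \<open>Conjugation\<close>

definition conjugate :: "(nat \<Rightarrow> nat) \<Rightarrow> nat \<Rightarrow> nat" where
  "conjugate p j = (LEAST i. p i \<le> j)"

text \<open>This Galois connection expresses that the diagram is transposed; the other facts on
  conjugation of partitions are drawn from it.\<close>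

lemma less_conjugate_iff:
  assumes "p \<in> par" shows "i < conjugate p j \<longleftrightarrow> j < p i"
proof -
  have "\<exists>i. p i \<le> j" using par_bound[OF assms] by (metis le0 order_refl)
  then have c: "p (conjugate p j) \<le> j" unfolding conjugate_def by (rule LeastI_ex)
  show ?thesis
  proof
    assume "i < conjugate p j"
    then show "j < p i" unfolding conjugate_def using not_less_Least not_le by blast
  next
    assume "j < p i"
    then show "i < conjugate p j"
      using c par_antimono[OF assms, of "conjugate p j" i] by (meson leI le_trans not_le)
  qed
qed

lemma eq_if_same_below: "(\<And>i. i < a \<longleftrightarrow> i < b) \<Longrightarrow> a = (b :: nat)"
  by (metis less_irrefl linorder_neqE_nat)

lemma conjugate_par [simp]:
  assumes "p \<in> par" shows "conjugate p \<in> par"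
proof (rule parI[of _ "p 0"])
  fix j
  show "conjugate p (Suc j) \<le> conjugate p j"
    using less_conjugate_iff[OF assms] by (metis Suc_lessD leI less_irrefl)
  show "conjugate p j = 0" if "p 0 \<le> j"
    using less_conjugate_iff[OF assms, of 0 j] that by simp
qed

lemma conjugate_conjugate [simp]: "p \<in> par \<Longrightarrow> conjugate (conjugate p) = p"
  by (rule ext, rule eq_if_same_below) (simp add: less_conjugate_iff)

lemma psize_conjugate [simp]:
  assumes "p \<in> par" shows "psize (conjugate p) = psize p"
proof -
  have "diagram (conjugate p) = prod.swap ` diagram p"
    using less_conjugate_iff[OF assms] by (force simp: diagram_def)
  then show ?thesis
    using assms by (simp add: diagram_finite_card(2)[symmetric] card_image)
qed

text \<open>Inequalities between row lengths are rewritten as implications between cells,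
  \<open>le\<close> and \<open>les\<close> treating numbers as initial segments. Transposing the
  cells then exchanges the two conditions.\<close>

lemma hstrip_iff_vstrip_conjugate:
  assumes "\<alpha> \<in> par" "\<mu> \<in> par"
  shows "hstrip \<alpha> \<mu> \<longleftrightarrow> vstrip (conjugate \<alpha>) (conjugate \<mu>)"
proof -
  have le: "a \<le> b \<longleftrightarrow> (\<forall>i<a. i < b)" for a b :: nat by (meson less_irrefl less_le_trans not_le)
  have les: "a \<le> Suc b \<longleftrightarrow> (\<forall>i. Suc i < a \<longrightarrow> i < b)" for a b :: nat
    by (metis Suc_less_eq lessI less_irrefl less_le_trans not_less_eq_eq not_le)
  show ?thesis unfolding hstrip_def vstrip_def les unfolding le
    using assms by (auto simp: less_conjugate_iff)
qed

lemma vstrips_conjugate: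
  assumes "\<alpha> \<in> par" shows "vstrips (conjugate \<alpha>) k = conjugate ` hstrips \<alpha> k"
proof (intro equalityI subsetI)
  fix \<rho> assume r: "\<rho> \<in> vstrips (conjugate \<alpha>) k"
  then have "\<rho> \<in> par" by (simp add: vstrips_def)
  then have "conjugate \<rho> \<in> hstrips \<alpha> k"
    using r assms hstrip_iff_vstrip_conjugate[of \<alpha> "conjugate \<rho>"] by (simp add: vstrips_def hstrips_def)
  then show "\<rho> \<in> conjugate ` hstrips \<alpha> k" using \<open>\<rho> \<in> par\<close> by (metis conjugate_conjugate imageI)
next
  fix \<rho> assume "\<rho> \<in> conjugate ` hstrips \<alpha> k"
  then obtain \<mu> where m: "\<rho> = conjugate \<mu>" "\<mu> \<in> hstrips \<alpha> k" by blast
  then have "\<mu> \<in> par" using assms hstrip_par_outer by (auto simp: hstrips_def)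
  then show "\<rho> \<in> vstrips (conjugate \<alpha>) k"
    using m assms hstrip_iff_vstrip_conjugate by (simp add: vstrips_def hstrips_def)
qed

lemma inj_on_conjugate: "inj_on conjugate par"
  by (metis conjugate_conjugate inj_onI)

lemma pieri_elementary_conjugate:
  assumes "\<alpha> \<in> par"
  shows "elementary n k * gtschur n (conjugate \<alpha>) = (\<Sum>\<mu>\<in>hstrips \<alpha> k. gtschur n (conjugate \<mu>))"
proof -
  have "hstrips \<alpha> k \<subseteq> par" using hstrips_subset[OF assms] by (auto simp: parts_def)
  then have "inj_on conjugate (hstrips \<alpha> k)" using inj_on_conjugate inj_on_subset by blast
  then show ?thesis using assms
    by (simp add: pieri_elementary vstrips_conjugate sum.reindex)
qed

text \<open>One coefficient family expands \<open>f\<close> in Schur polynomials and \<open>g\<close> in the conjugate ones, in every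
  number of variables at once; thus \<open>g\<close> is the image of \<open>f\<close> under the involution \<open>\<omega>\<close>.\<close>

definition conj_expansion :: "nat \<Rightarrow> (nat \<Rightarrow> mpoly) \<Rightarrow> (nat \<Rightarrow> mpoly) \<Rightarrow> bool" where
  "conj_expansion d f g \<longleftrightarrow> (\<exists>u :: (nat \<Rightarrow> nat) \<Rightarrow> int. \<forall>n.
     f n = (\<Sum>\<nu>\<in>parts d. of_int (u \<nu>) * gtschur n \<nu>) \<and>
     g n = (\<Sum>\<nu>\<in>parts d. of_int (u \<nu>) * gtschur n (conjugate \<nu>)))"

lemma conj_expansion_zero: "conj_expansion d (\<lambda>_. 0) (\<lambda>_. 0)"
  unfolding conj_expansion_def by (rule exI[of _ "\<lambda>_. 0"]) simp

lemma conj_expansion_gtschur: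
  assumes "\<nu> \<in> parts d"
  shows "conj_expansion d (\<lambda>n. gtschur n \<nu>) (\<lambda>n. gtschur n (conjugate \<nu>))"
proof -
  have "of_int (if \<mu> = \<nu> then 1 else 0) * (x :: mpoly) = (if \<mu> = \<nu> then x else 0)" for \<mu> x by simp
  then show ?thesis
    unfolding conj_expansion_def
    by (intro exI[of _ "\<lambda>\<mu>. if \<mu> = \<nu> then 1 else 0"]) (simp add: assms)
qed

lemma conj_expansion_add:
  assumes "conj_expansion d f g" "conj_expansion d f' g'"
  shows "conj_expansion d (\<lambda>n. f n + f' n) (\<lambda>n. g n + g' n)"
proof -
  obtain u v where
    "\<forall>n. f n = (\<Sum>\<nu>\<in>parts d. of_int (u \<nu>) * gtschur n \<nu>) \<and>
     g n = (\<Sum>\<nu>\<in>parts d. of_int (u \<nu>) * gtschur n (conjugate \<nu>))"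
    "\<forall>n. f' n = (\<Sum>\<nu>\<in>parts d. of_int (v \<nu>) * gtschur n \<nu>) \<and>
     g' n = (\<Sum>\<nu>\<in>parts d. of_int (v \<nu>) * gtschur n (conjugate \<nu>))"
    using assms unfolding conj_expansion_def by blast
  then show ?thesis unfolding conj_expansion_def
    by (intro exI[of _ "\<lambda>\<nu>. u \<nu> + v \<nu>"]) (simp add: sum.distrib algebra_simps)
qed

lemma conj_expansion_scale:
  assumes "conj_expansion d f g"
  shows "conj_expansion d (\<lambda>n. of_int c * f n) (\<lambda>n. of_int c * g n)"
proof -
  obtain u where
    "\<forall>n. f n = (\<Sum>\<nu>\<in>parts d. of_int (u \<nu>) * gtschur n \<nu>) \<and>
     g n = (\<Sum>\<nu>\<in>parts d. of_int (u \<nu>) * gtschur n (conjugate \<nu>))"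
    using assms unfolding conj_expansion_def by blast
  then show ?thesis unfolding conj_expansion_def
    by (intro exI[of _ "\<lambda>\<nu>. c * u \<nu>"]) (simp add: sum_distrib_left mult.assoc)
qed

lemma conj_expansion_diff:
  assumes "conj_expansion d f g" "conj_expansion d f' g'"
  shows "conj_expansion d (\<lambda>n. f n - f' n) (\<lambda>n. g n - g' n)"
  using conj_expansion_add[OF assms(1) conj_expansion_scale[OF assms(2), of "-1"]] by simp

lemma conj_expansion_sum:
  assumes "\<And>i. i \<in> I \<Longrightarrow> conj_expansion d (f i) (g i)"
  shows "conj_expansion d (\<lambda>n. \<Sum>i\<in>I. f i n) (\<lambda>n. \<Sum>i\<in>I. g i n)"
  using assms
proof (induction I rule: infinite_finite_induct)
  case (insert i I)
  then show ?case using conj_expansion_add[of d "f i" "g i"] by simp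
qed (simp_all add: conj_expansion_zero)

text \<open>Both Pieri rules are summed over the same index set \<open>hstrips \<nu> k\<close>, so
  one coefficient family still serves both expansions.\<close>

lemma conj_expansion_pieri:
  assumes "conj_expansion d f g"
  shows "conj_expansion (d + k) (\<lambda>n. complete n k * f n) (\<lambda>n. elementary n k * g n)"
proof -
  obtain u where u:
    "\<And>n. f n = (\<Sum>\<nu>\<in>parts d. of_int (u \<nu>) * gtschur n \<nu>)"
    "\<And>n. g n = (\<Sum>\<nu>\<in>parts d. of_int (u \<nu>) * gtschur n (conjugate \<nu>))"
    using assms unfolding conj_expansion_def by blast
  have p: "\<nu> \<in> par" if "\<nu> \<in> parts d" for \<nu> using that by (simp add: parts_def)
  have m: "\<mu> \<in> parts (d + k)" if "\<nu> \<in> parts d" "\<mu> \<in> hstrips \<nu> k" for \<mu> \<nu>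
    using that hstrips_subset[of \<nu> k] by (auto simp: parts_def)
  have "complete n k * f n = (\<Sum>\<nu>\<in>parts d. of_int (u \<nu>) * (\<Sum>\<mu>\<in>hstrips \<nu> k. gtschur n \<mu>))" for n
    unfolding u sum_distrib_left[of "complete n k"]
    by (intro sum.cong refl) (simp add: pieri_complete[OF p, symmetric] mult_ac)
  moreover have "elementary n k * g n
      = (\<Sum>\<nu>\<in>parts d. of_int (u \<nu>) * (\<Sum>\<mu>\<in>hstrips \<nu> k. gtschur n (conjugate \<mu>)))" for n
    unfolding u sum_distrib_left[of "elementary n k"]
    by (intro sum.cong refl) (simp add: pieri_elementary_conjugate[OF p, symmetric] mult_ac)
  ultimately show ?thesis
    by (auto intro!: conj_expansion_sum conj_expansion_scale conj_expansion_gtschur intro: m)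
qed

lemma psize_shift:
  assumes "p \<in> par" shows "p \<circ> Suc \<in> par" "psize p = p 0 + psize (p \<circ> Suc)"
proof -
  obtain m where m: "\<forall>i\<ge>m. p i = 0" using par_bound[OF assms] by blast
  then show "p \<circ> Suc \<in> par" using assms by (intro parI[of _ m]) (auto simp: par_def)
  have "psize p = (\<Sum>i<Suc m. p i)" using m by (intro psize_eq_sum) auto
  also have "\<dots> = p 0 + (\<Sum>i<m. (p \<circ> Suc) i)" unfolding sum.lessThan_Suc_shift by simp
  also have "(\<Sum>i<m. (p \<circ> Suc) i) = psize (p \<circ> Suc)"
    using m by (intro psize_eq_sum[symmetric]) auto
  finally show "psize p = p 0 + psize (p \<circ> Suc)" .
qed

text \<open>Interlacing bounds the rows of \<open>\<mu>\<close> after the first by those of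
  \<open>\<alpha>\<close>. If their sizes agree, then so do these rows, and the equal total sizes
  force equal first rows as well. This drop makes the recursion on Schur polynomials
  terminate.\<close>

lemma remove_row_hstrips:
  assumes "\<alpha> \<in> par"
  shows "\<alpha> \<in> hstrips (\<alpha> \<circ> Suc) (\<alpha> 0)"
    and "\<mu> \<in> hstrips (\<alpha> \<circ> Suc) (\<alpha> 0) \<Longrightarrow> \<mu> \<noteq> \<alpha> \<Longrightarrow> psize (\<mu> \<circ> Suc) < psize (\<alpha> \<circ> Suc)"
proof -
  show "\<alpha> \<in> hstrips (\<alpha> \<circ> Suc) (\<alpha> 0)"
    using assms psize_shift[OF assms] by (auto simp: hstrips_def hstrip_def par_def)
  assume m: "\<mu> \<in> hstrips (\<alpha> \<circ> Suc) (\<alpha> 0)" and ne: "\<mu> \<noteq> \<alpha>"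
  have a: "\<alpha> \<circ> Suc \<in> par" using assms psize_shift by blast
  then have mp: "\<mu> \<in> par" using m hstrip_par_outer by (auto simp: hstrips_def)
  have le: "(\<mu> \<circ> Suc) i \<le> (\<alpha> \<circ> Suc) i" for i using m by (simp add: hstrips_def hstrip_def)
  have "psize (\<mu> \<circ> Suc) \<noteq> psize (\<alpha> \<circ> Suc)"
  proof
    assume eq: "psize (\<mu> \<circ> Suc) = psize (\<alpha> \<circ> Suc)"
    then have s: "\<mu> \<circ> Suc = \<alpha> \<circ> Suc" using psize_eq_imp_eq[OF a le] by blast
    have "psize \<mu> = psize \<alpha>" using m psize_shift[OF assms] by (simp add: hstrips_def)
    then have "\<mu> 0 = \<alpha> 0" using eq psize_shift[OF mp] psize_shift[OF assms] by simp
    then have "\<mu> i = \<alpha> i" for i using s by (cases i) (auto simp: fun_eq_iff)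
    then show False using ne by blast
  qed
  moreover have "psize (\<mu> \<circ> Suc) \<le> psize (\<alpha> \<circ> Suc)" using a le by (rule psize_mono)
  ultimately show "psize (\<mu> \<circ> Suc) < psize (\<alpha> \<circ> Suc)" by simp
qed

text \<open>With the first row of \<open>\<alpha>\<close> removed, the Pieri rule for
  \<open>h\<close> produces \<open>\<alpha>\<close> itself and shapes of the same size with fewer
  cells after the first row. Induction on that number of cells handles these shapes, which are then
  subtracted; the conjugate side runs in parallel with \<open>e\<close>.\<close>

lemma conj_expansion_mult:
  assumes "\<alpha> \<in> par" "conj_expansion d f g"
  shows "conj_expansion (d + psize \<alpha>) (\<lambda>n. gtschur n \<alpha> * f n) (\<lambda>n. gtschur n (conjugate \<alpha>) * g n)"
  using assms(1)
proof (induction "psize (\<alpha> \<circ> Suc)" arbitrary: \<alpha> rule: less_induct)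
  case less
  let ?b = "\<alpha> \<circ> Suc" and ?k = "\<alpha> 0"
  let ?H = "hstrips ?b ?k - {\<alpha>}"
  note b = psize_shift[OF less.prems]
  have fin: "finite (hstrips ?b ?k)" using b(1) by (rule finite_hstrips)
  have "conj_expansion (d + psize ?b) (\<lambda>n. gtschur n ?b * f n) (\<lambda>n. gtschur n (conjugate ?b) * g n)"
  proof (cases "psize ?b = 0")
    \<comment> \<open>The measure does not decrease from \<open>\<alpha>\<close> to an empty
      \<open>?b\<close>; here the claim is the assumption on \<open>f\<close> and \<open>g\<close>
      itself.\<close>
    case True
    then have z: "?b = (\<lambda>_. 0)" using b(1) psize_zero_iff by blast
    moreover have "conjugate (\<lambda>_. 0) = (\<lambda>_. 0)" by (auto simp: conjugate_def)
    ultimately show ?thesis using assms(2) by simp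
  next
    case False
    have "psize (?b \<circ> Suc) < psize ?b"
    proof (rule ccontr)
      assume "\<not> ?thesis"
      then have "?b 0 = 0" using psize_shift[OF b(1)] by simp
      then have "?b i = 0" for i using par_zeroD[OF b(1), of 0 i] by simp
      then have "?b = (\<lambda>_. 0)" by blast
      then show False using False by simp
    qed
    then show ?thesis using less.hyps b(1) by blast
  qed
  then have "conj_expansion (d + psize ?b + ?k) (\<lambda>n. complete n ?k * (gtschur n ?b * f n))
      (\<lambda>n. elementary n ?k * (gtschur n (conjugate ?b) * g n))"
    by (rule conj_expansion_pieri)
  then have E: "conj_expansion (d + psize \<alpha>) (\<lambda>n. complete n ?k * (gtschur n ?b * f n))
      (\<lambda>n. elementary n ?k * (gtschur n (conjugate ?b) * g n))"
    using b(2) by (simp add: ac_simps)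
  have "conj_expansion (d + psize \<alpha>) (\<lambda>n. gtschur n \<mu> * f n) (\<lambda>n. gtschur n (conjugate \<mu>) * g n)"
    if "\<mu> \<in> ?H" for \<mu>
  proof -
    have "\<mu> \<in> par" "psize \<mu> = psize \<alpha>"
      using that b hstrip_par_outer by (auto simp: hstrips_def)
    then show ?thesis using less.hyps[of \<mu>] that remove_row_hstrips(2)[OF less.prems] by auto
  qed
  then have "conj_expansion (d + psize \<alpha>) (\<lambda>n. \<Sum>\<mu>\<in>?H. gtschur n \<mu> * f n)
     (\<lambda>n. \<Sum>\<mu>\<in>?H. gtschur n (conjugate \<mu>) * g n)"
    by (rule conj_expansion_sum)
  note D = conj_expansion_diff[OF E this]
  have "complete n ?k * (gtschur n ?b * f n) - (\<Sum>\<mu>\<in>?H. gtschur n \<mu> * f n) = gtschur n \<alpha> * f n" for n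
    using fin remove_row_hstrips(1)[OF less.prems]
    by (simp add: mult.assoc[symmetric] pieri_complete[OF b(1)] sum_distrib_right sum_diff1)
  moreover have "elementary n ?k * (gtschur n (conjugate ?b) * g n)
      - (\<Sum>\<mu>\<in>?H. gtschur n (conjugate \<mu>) * g n) = gtschur n (conjugate \<alpha>) * g n" for n
    using fin remove_row_hstrips(1)[OF less.prems]
    by (simp add: mult.assoc[symmetric] pieri_elementary_conjugate[OF b(1)] sum_distrib_right sum_diff1)
  ultimately show ?case using D by simp
qed

lemma conj_expansion_prod:
  assumes "\<And>\<alpha>. \<alpha> \<in> set as \<Longrightarrow> \<alpha> \<in> par"
  shows "conj_expansion (sum_list (map psize as)) (\<lambda>n. prod_list (map (gtschur n) as))
    (\<lambda>n. prod_list (map (\<lambda>\<alpha>. gtschur n (conjugate \<alpha>)) as))"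
  using assms
proof (induction as)
  case Nil
  have "conjugate (\<lambda>_. 0) = (\<lambda>_. 0)" by (auto simp: conjugate_def)
  then show ?case using conj_expansion_gtschur[of "\<lambda>_. 0" 0] by (simp add: parts_def)
next
  case (Cons \<alpha> as)
  then show ?case
    using conj_expansion_mult[of \<alpha> "sum_list (map psize as)" "\<lambda>n. prod_list (map (gtschur n) as)"
      "\<lambda>n. prod_list (map (\<lambda>\<alpha>. gtschur n (conjugate \<alpha>)) as)"]
    by (simp add: add.commute)
qed

section \<open>Linear independence\<close>

definition expo :: "nat \<Rightarrow> (nat \<Rightarrow> nat) \<Rightarrow> nat \<Rightarrow>\<^sub>0 nat" where
  "expo n \<alpha> = (\<Sum>i<n. Poly_Mapping.single i (\<alpha> i))"

lemma lookup_expo: "Poly_Mapping.lookup (expo n \<alpha>) i = (if i < n then \<alpha> i else 0)"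
  unfolding expo_def lookup_sum by (simp add: lookup_single when_def)

lemma lookup_single_times_add:
  fixes f :: mpoly
  shows "Poly_Mapping.lookup (Poly_Mapping.single a c * f) (a + b) = c * Poly_Mapping.lookup f b"
  by (simp add: lookup_mult lookup_single when_mult)

lemma of_int_mpoly: "(of_int c :: mpoly) = Poly_Mapping.single 0 c"
  by (simp add: single_of_int[symmetric] del: single_of_int)

lemma lookup_of_int_times: "Poly_Mapping.lookup (of_int c * f :: mpoly) b = c * Poly_Mapping.lookup f b"
  using lookup_single_times_add[of 0 c f b] by (simp add: of_int_mpoly)

lemma keys_gtschur_length: "t \<in> Poly_Mapping.keys (gtschur n \<alpha>) \<Longrightarrow> \<alpha> n = 0"
  by (rule ccontr) (simp add: gtschur_long)

text \<open>Exponents are dominated by the shape. Up to \<open>k = n\<close> the bound is inherited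
  from \<open>\<mu>\<close>, which lies inside \<open>\<alpha>\<close>; for \<open>k = Suc n\<close>
  the added power of the last variable completes the degree to at most
  \<open>psize \<alpha>\<close>.\<close>

lemma keys_gtschur:
  assumes "\<alpha> \<in> par" "t \<in> Poly_Mapping.keys (gtschur n \<alpha>)"
  shows "(\<forall>k\<le>n. (\<Sum>i<k. Poly_Mapping.lookup t i) \<le> (\<Sum>i<k. \<alpha> i)) \<and> (\<forall>i\<ge>n. Poly_Mapping.lookup t i = 0)"
  using assms
proof (induction n arbitrary: \<alpha> t)
  case 0
  then show ?case by (auto split: if_splits)
next
  case (Suc n)
  have "\<alpha> (Suc n) = 0" using Suc.prems(2) by (rule keys_gtschur_length)
  then have sa: "psize \<alpha> = (\<Sum>i<Suc n. \<alpha> i)" using par_zeroD[OF Suc.prems(1)] by (intro psize_eq_sum) auto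
  obtain \<mu> where h: "hstrip \<mu> \<alpha>" and "t \<in> Poly_Mapping.keys (xpow n (psize \<alpha> - psize \<mu>) * gtschur n \<mu>)"
    using Suc.prems(2) keys_sum[of "\<lambda>\<mu>. xpow n (psize \<alpha> - psize \<mu>) * gtschur n \<mu>" "{\<mu>. hstrip \<mu> \<alpha>}"]
    by auto
  then obtain s where t: "t = Poly_Mapping.single n (psize \<alpha> - psize \<mu>) + s" and s: "s \<in> Poly_Mapping.keys (gtschur n \<mu>)"
    using keys_mult[of "xpow n (psize \<alpha> - psize \<mu>)" "gtschur n \<mu>"] by (auto simp: xpow_def)
  have mp: "\<mu> \<in> par" using h Suc.prems(1) hstrip_par_inner by blast
  note IH = Suc.IH[OF mp s]
  have lt: "Poly_Mapping.lookup t i = (if i = n then psize \<alpha> - psize \<mu> else 0) + Poly_Mapping.lookup s i" for i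
    by (simp add: t lookup_add lookup_single when_def)
  have "\<mu> n = 0" using s by (rule keys_gtschur_length)
  then have sm: "psize \<mu> = (\<Sum>i<n. \<mu> i)" using par_zeroD[OF mp] by (intro psize_eq_sum) auto
  have low: "(\<Sum>i<k. Poly_Mapping.lookup t i) = (\<Sum>i<k. Poly_Mapping.lookup s i)" if "k \<le> n" for k
    using that by (intro sum.cong) (auto simp: lt)
  have "(\<Sum>i<k. Poly_Mapping.lookup t i) \<le> (\<Sum>i<k. \<alpha> i)" if "k \<le> Suc n" for k
  proof (cases "k \<le> n")
    case True
    have "(\<Sum>i<k. Poly_Mapping.lookup s i) \<le> (\<Sum>i<k. \<mu> i)" using IH True by blast
    also have "\<dots> \<le> (\<Sum>i<k. \<alpha> i)" by (intro sum_mono hstrip_le[OF h])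
    finally show ?thesis using low[OF True] by simp
  next
    case False
    then have k: "k = Suc n" using that by simp
    have "(\<Sum>i<n. Poly_Mapping.lookup s i) \<le> psize \<mu>" unfolding sm using IH by blast
    moreover have "psize \<mu> \<le> psize \<alpha>" using h Suc.prems(1) by (rule hstrip_psize)
    ultimately have "(\<Sum>i<k. Poly_Mapping.lookup t i) \<le> psize \<alpha>" using low[of n] IH by (simp add: k lt)
    then show ?thesis by (simp add: k sa)
  qed
  moreover have "Poly_Mapping.lookup t i = 0" if "Suc n \<le> i" for i using that IH by (simp add: lt)
  ultimately show ?case by blast
qed

text \<open>Only \<open>\<mu> = \<beta>\<close>, obtained by clearing row \<open>n\<close>,
  contributes: for any other \<open>\<mu>\<close>, dominance makes its first \<open>n\<close> rows
  sum to at least those of \<open>\<alpha>\<close>, while each is at most the row of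
  \<open>\<alpha>\<close>, so they coincide.\<close>

lemma lookup_gtschur_expo:
  assumes "\<alpha> \<in> par" "\<alpha> n = 0"
  shows "Poly_Mapping.lookup (gtschur n \<alpha>) (expo n \<alpha>) = 1"
  using assms
proof (induction n arbitrary: \<alpha>)
  case 0
  then have "\<alpha> = (\<lambda>_. 0)" using par_zeroD[OF 0(1), of 0] by auto
  then show ?case by (simp add: expo_def)
next
  case (Suc n)
  define \<beta> where "\<beta> = \<alpha>(n := 0)"
  let ?I = "{\<mu>. hstrip \<mu> \<alpha>}"
  let ?f = "\<lambda>\<mu>. Poly_Mapping.lookup (xpow n (psize \<alpha> - psize \<mu>) * gtschur n \<mu>) (expo (Suc n) \<alpha>)"
  have z: "\<alpha> i = 0" if "Suc n \<le> i" for i using that par_zeroD[OF Suc.prems] by blast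
  have h: "hstrip \<beta> \<alpha>" using Suc.prems by (auto simp: hstrip_def \<beta>_def par_def)
  have bp: "\<beta> \<in> par" using h Suc.prems(1) hstrip_par_inner by blast
  have ps: "psize \<alpha> - psize \<beta> = \<alpha> n" using psize_update[OF Suc.prems(1), of n 0] by (simp add: \<beta>_def)
  have ex: "expo (Suc n) \<alpha> = Poly_Mapping.single n (\<alpha> n) + expo n \<beta>"
    by (rule poly_mapping_eqI) (auto simp: lookup_expo lookup_add lookup_single when_def \<beta>_def less_Suc_eq)
  have "?f \<mu> = 0" if "\<mu> \<in> ?I - {\<beta>}" for \<mu>
  proof (rule ccontr)
    assume "?f \<mu> \<noteq> 0"
    have hm: "hstrip \<mu> \<alpha>" using that by simp
    then have mp: "\<mu> \<in> par" using Suc.prems(1) hstrip_par_inner by blast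
    from \<open>?f \<mu> \<noteq> 0\<close> have "expo (Suc n) \<alpha> \<in> Poly_Mapping.keys (xpow n (psize \<alpha> - psize \<mu>) * gtschur n \<mu>)"
      by (simp add: in_keys_iff)
    then obtain s where t: "expo (Suc n) \<alpha> = Poly_Mapping.single n (psize \<alpha> - psize \<mu>) + s"
      and s: "s \<in> Poly_Mapping.keys (gtschur n \<mu>)"
      using keys_mult[of "xpow n (psize \<alpha> - psize \<mu>)" "gtschur n \<mu>"] by (auto simp: xpow_def)
    have ls: "Poly_Mapping.lookup s i = \<alpha> i" if "i < n" for i
      using arg_cong[OF t, of "\<lambda>t. Poly_Mapping.lookup t i"] that
      by (simp add: lookup_expo lookup_add lookup_single when_def)
    have "(\<Sum>i<n. Poly_Mapping.lookup s i) \<le> (\<Sum>i<n. \<mu> i)" using keys_gtschur[OF mp s] by blast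
    then have le: "(\<Sum>i<n. \<alpha> i) \<le> (\<Sum>i<n. \<mu> i)" by (simp add: ls)
    have "\<mu> i = \<alpha> i" if "i < n" for i
    proof (rule sum_mono_inv[of \<mu> "{..<n}" \<alpha>])
      show "(\<Sum>i<n. \<mu> i) = (\<Sum>i<n. \<alpha> i)"
        using le sum_mono[of "{..<n}" \<mu> \<alpha>] hstrip_le[OF hm] by (simp add: le_antisym)
    qed (use that hstrip_le[OF hm] in auto)
    moreover have "\<mu> n = 0" using s by (rule keys_gtschur_length)
    then have "\<mu> i = 0" if "n \<le> i" for i using that mp par_zeroD by blast
    ultimately have "\<mu> i = \<beta> i" for i
      using z[of i] by (cases "i < n") (auto simp: \<beta>_def)
    then show False using that by blast
  qed
  then have "Poly_Mapping.lookup (gtschur (Suc n) \<alpha>) (expo (Suc n) \<alpha>) = ?f \<beta>"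
    using finite_hstrip_inner[OF Suc.prems(1)] h
    by (simp add: lookup_sum lookup_add sum.remove[of ?I \<beta>])
  also have "\<dots> = Poly_Mapping.lookup (gtschur n \<beta>) (expo n \<beta>)"
    by (simp add: ps ex xpow_def lookup_single_times_add)
  also have "\<dots> = 1" by (rule Suc.IH[OF bp]) (simp add: \<beta>_def)
  finally show ?case .
qed

text \<open>Unitriangularity: among the partitions with nonzero coefficient take
  \<open>\<beta>\<close> with maximal \<open>F\<close>. By dominance the monomial with exponents
  \<open>\<beta>\<close> occurs in no other term of the sum that has a nonzero coefficient, and it
  occurs once in the term of \<open>\<beta>\<close>.\<close>

lemma gtschur_independent:
  fixes u :: "(nat \<Rightarrow> nat) \<Rightarrow> int"
  assumes "finite A" and A: "\<And>\<nu>. \<nu> \<in> A \<Longrightarrow> \<nu> \<in> par \<and> \<nu> n = 0"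
    and zero: "(\<Sum>\<nu>\<in>A. of_int (u \<nu>) * gtschur n \<nu>) = 0" and "\<nu> \<in> A"
  shows "u \<nu> = 0"
proof (rule ccontr)
  assume "u \<nu> \<noteq> 0"
  define B where "B = {\<nu>\<in>A. u \<nu> \<noteq> 0}"
  \<comment> \<open>\<open>F\<close> is strictly monotone for the dominance order on partitions of length at most \<open>n\<close>.\<close>
  define F where "F = (\<lambda>\<nu> :: nat \<Rightarrow> nat. \<Sum>k\<le>n. \<Sum>i<k. \<nu> i)"
  have "finite B" "B \<noteq> {}" using assms(1,4) \<open>u \<nu> \<noteq> 0\<close> by (auto simp: B_def)
  then have "Max (F ` B) \<in> F ` B" by simp
  then obtain \<beta> where b: "\<beta> \<in> B" "F \<beta> = Max (F ` B)" by auto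
  have bmax: "F \<mu> \<le> F \<beta>" if "\<mu> \<in> B" for \<mu> using that b(2) \<open>finite B\<close> by simp
  have bA: "\<beta> \<in> A" using b(1) by (simp add: B_def)
  have "u \<mu> * Poly_Mapping.lookup (gtschur n \<mu>) (expo n \<beta>) = 0" if m: "\<mu> \<in> A - {\<beta>}" for \<mu>
  proof (rule ccontr)
    assume "u \<mu> * Poly_Mapping.lookup (gtschur n \<mu>) (expo n \<beta>) \<noteq> 0"
    then have mB: "\<mu> \<in> B" and key: "expo n \<beta> \<in> Poly_Mapping.keys (gtschur n \<mu>)"
      using m by (auto simp: B_def in_keys_iff)
    have mp: "\<mu> \<in> par" "\<mu> n = 0" using m A by auto
    have bp: "\<beta> \<in> par" "\<beta> n = 0" using bA A by auto
    have le: "(\<Sum>i<k. \<beta> i) \<le> (\<Sum>i<k. \<mu> i)" if "k \<le> n" for k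
    proof -
      have "(\<Sum>i<k. Poly_Mapping.lookup (expo n \<beta>) i) \<le> (\<Sum>i<k. \<mu> i)" using keys_gtschur[OF mp(1) key] that by blast
      moreover have "(\<Sum>i<k. Poly_Mapping.lookup (expo n \<beta>) i) = (\<Sum>i<k. \<beta> i)"
        using that by (intro sum.cong) (auto simp: lookup_expo)
      ultimately show ?thesis by simp
    qed
    have "F \<beta> \<le> F \<mu>" unfolding F_def by (rule sum_mono[OF le]) simp
    then have "F \<beta> = F \<mu>" using bmax[OF mB] by simp
    \<comment> \<open>Termwise comparable sums with equal totals agree termwise, so all partial sums
      coincide and their differences recover the entries.\<close>
    then have eq: "(\<Sum>i<k. \<beta> i) = (\<Sum>i<k. \<mu> i)" if "k \<le> n" for k
      using sum_mono_inv[of "\<lambda>k. \<Sum>i<k. \<beta> i" "{..n}" "\<lambda>k. \<Sum>i<k. \<mu> i" k] le that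
      unfolding F_def by auto
    have "\<beta> i = \<mu> i" for i
    proof (cases "i < n")
      case True
      then show ?thesis using eq[of i] eq[of "Suc i"] by simp
    next
      case False
      then show ?thesis using par_zeroD[OF mp, of i] par_zeroD[OF bp, of i] by simp
    qed
    then have "\<beta> = \<mu>" by (rule ext)
    then show False using m by blast
  qed
  then have "(\<Sum>\<mu>\<in>A. u \<mu> * Poly_Mapping.lookup (gtschur n \<mu>) (expo n \<beta>)) = u \<beta> * Poly_Mapping.lookup (gtschur n \<beta>) (expo n \<beta>)"
    using assms(1) bA by (subst sum.remove[of A \<beta>]) (simp_all add: sum.neutral del: mult_eq_0_iff)
  also have "\<dots> = u \<beta>" using lookup_gtschur_expo A[OF bA] by simp
  finally have "u \<beta> = Poly_Mapping.lookup (\<Sum>\<nu>\<in>A. of_int (u \<nu>) * gtschur n \<nu>) (expo n \<beta>)"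
    by (simp add: lookup_sum lookup_of_int_times)
  then show False using zero b(1) by (simp add: B_def)
qed

section \<open>Complementation in a box\<close>

text \<open>\<open>reversal b f g\<close> says that \<open>g(x) = x^b f(1/x)\<close>, without leaving the polynomial ring.\<close>

inductive reversal :: "(nat \<Rightarrow>\<^sub>0 nat) \<Rightarrow> mpoly \<Rightarrow> mpoly \<Rightarrow> bool" for b where
  zero: "reversal b 0 0"
| single: "m + m' = b \<Longrightarrow> reversal b (Poly_Mapping.single m c) (Poly_Mapping.single m' c)"
| add: "reversal b f g \<Longrightarrow> reversal b f' g' \<Longrightarrow> reversal b (f + f') (g + g')"

text \<open>A polynomial can be built from monomials in many ways. Reading off coefficients shows
  that \<open>g\<close> is nevertheless determined by \<open>f\<close>; the second clause covers
  exponents not dividing \<open>b\<close>.\<close>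

lemma reversal_lookup:
  assumes "reversal b f g"
  shows "(m + m' = b \<longrightarrow> Poly_Mapping.lookup g m' = Poly_Mapping.lookup f m) \<and>
    ((\<nexists>m. m + m' = b) \<longrightarrow> Poly_Mapping.lookup g m' = 0)"
  using assms
proof (induction rule: reversal.induct)
  case (single k k' c)
  then have "k' = m' \<longleftrightarrow> k = m" if "m + m' = b"
    using that by (metis add_left_cancel add_right_cancel)
  then show ?case using single by (auto simp: lookup_single when_def)
qed (auto simp: lookup_add)

lemma reversal_unique:
  assumes "reversal b f g" "reversal b f g'" shows "g = g'"
proof (rule poly_mapping_eqI)
  fix m'
  show "Poly_Mapping.lookup g m' = Poly_Mapping.lookup g' m'"
    using reversal_lookup[OF assms(1), of _ m'] reversal_lookup[OF assms(2), of _ m'] by metis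
qed

lemma reversal_sum:
  assumes "\<And>i. i \<in> I \<Longrightarrow> reversal b (f i) (g i)"
  shows "reversal b (\<Sum>i\<in>I. f i) (\<Sum>i\<in>I. g i)"
  using assms by (induction I rule: infinite_finite_induct) (auto intro: reversal.intros)

lemma reversal_mult:
  assumes "reversal b f g" "reversal b' f' g'"
  shows "reversal (b + b') (f * f') (g * g')"
  using assms(1)
proof (induction rule: reversal.induct)
  case (single m m' c)
  from assms(2) show ?case
  proof (induction rule: reversal.induct)
    case (single k k' d)
    have "m + k + (m' + k') = b + b'"
      using \<open>m + m' = b\<close> \<open>k + k' = b'\<close> by (metis add.assoc add.commute)
    then show ?case by (simp add: mult_single reversal.single)
  qed (simp_all add: distrib_left reversal.intros)
qed (simp_all add: distrib_right reversal.intros)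

lemma reversal_one: "reversal b 1 (Poly_Mapping.single b 1)"
  using reversal.single[of 0 b b 1] by simp

lemma reversal_of_int:
  assumes "reversal b f g" shows "reversal b (of_int c * f) (of_int c * g)"
proof -
  have "reversal 0 (of_int c) (of_int c)" using reversal.single[of 0 0 0 c] by (simp add: of_int_mpoly)
  then show ?thesis using reversal_mult[of 0 _ _ b f g] assms by simp
qed

lemma reversal_prod_list:
  assumes "\<And>l. l \<in> set L \<Longrightarrow> reversal (b l) (f l) (g l)"
  shows "reversal (sum_list (map b L)) (prod_list (map f L)) (prod_list (map g L))"
  using assms
proof (induction L)
  case Nil
  show ?case using reversal_one[of 0] by simp
qed (auto intro: reversal_mult)

definition box_complement :: "nat \<Rightarrow> nat \<Rightarrow> (nat \<Rightarrow> nat) \<Rightarrow> nat \<Rightarrow> nat" where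
  "box_complement n b p i = (if i < n then b - p (n - 1 - i) else 0)"

definition in_box :: "nat \<Rightarrow> nat \<Rightarrow> (nat \<Rightarrow> nat) \<Rightarrow> bool" where
  "in_box n b p \<longleftrightarrow> p \<in> par \<and> p n = 0 \<and> p 0 \<le> b"

lemma in_box_le: "in_box n b p \<Longrightarrow> p i \<le> b"
  using par_antimono[of p 0 i] by (simp add: in_box_def)

lemma in_box_zero: "in_box n b p \<Longrightarrow> n \<le> i \<Longrightarrow> p i = 0"
  using par_zeroD[of p n i] by (simp add: in_box_def)

lemma in_box_complement:
  assumes "in_box n b p" shows "in_box n b (box_complement n b p)"
proof -
  have "box_complement n b p (Suc i) \<le> box_complement n b p i" for i
    using assms par_antimono[of p "n - 1 - Suc i" "n - 1 - i"]
    by (auto simp: box_complement_def in_box_def diff_le_mono2)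
  then have "box_complement n b p \<in> par"
    by (intro parI[of _ n]) (auto simp: box_complement_def)
  then show ?thesis by (simp add: in_box_def box_complement_def)
qed

lemma box_complement_involutive:
  assumes "in_box n b p" shows "box_complement n b (box_complement n b p) = p"
proof
  fix i
  show "box_complement n b (box_complement n b p) i = p i"
    using in_box_le[OF assms, of i] in_box_zero[OF assms, of i]
    by (auto simp: box_complement_def)
qed

lemma psize_in_box: "in_box n b p \<Longrightarrow> psize p = (\<Sum>i<n. p i)"
  using in_box_zero by (intro psize_eq_sum) blast

lemma psize_box_complement:
  assumes "in_box n b p" shows "psize (box_complement n b p) + psize p = n * b"
proof -
  have "psize (box_complement n b p) = (\<Sum>i<n. b - p (n - Suc i))"
    by (subst psize_eq_sum[of n]) (auto simp: box_complement_def)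
  also have "\<dots> = (\<Sum>i<n. b - p i)" by (rule sum.nat_diff_reindex)
  finally have "psize (box_complement n b p) + psize p = (\<Sum>i<n. (b - p i) + p i)"
    using psize_in_box[OF assms] by (simp add: sum.distrib)
  also have "\<dots> = n * b" using in_box_le[OF assms] by simp
  finally show ?thesis .
qed

text \<open>The boxes have the same width but \<open>n\<close> and \<open>Suc n\<close> rows.
  Reversing the rows with this offset of one exchanges the two interlacing inequalities, so inner
  and outer keep their roles.\<close>

lemma hstrip_box_complement:
  assumes "in_box (Suc n) b \<alpha>" "hstrip \<mu> \<alpha>" "\<mu> n = 0"
  shows "in_box n b \<mu>" "hstrip (box_complement n b \<mu>) (box_complement (Suc n) b \<alpha>)"
proof -
  show "in_box n b \<mu>" using assms hstrip_par_inner[OF assms(2)] hstrip_le[OF assms(2), of 0]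
    by (auto simp: in_box_def)
  show "hstrip (box_complement n b \<mu>) (box_complement (Suc n) b \<alpha>)"
    unfolding hstrip_def
  proof (intro allI conjI)
    fix i
    show "box_complement n b \<mu> i \<le> box_complement (Suc n) b \<alpha> i"
    proof (cases "i < n")
      case True
      then have "\<alpha> (n - i) \<le> \<mu> (n - Suc i)"
        using hstrip_Suc_le[OF assms(2), of "n - Suc i"] by (simp add: Suc_diff_Suc)
      then show ?thesis using True by (auto simp: box_complement_def)
    qed (simp add: box_complement_def)
    show "box_complement (Suc n) b \<alpha> (Suc i) \<le> box_complement n b \<mu> i"
      using hstrip_le[OF assms(2), of "n - Suc i"] by (auto simp: box_complement_def)
  qed
qed

definition rect_expo :: "nat \<Rightarrow> nat \<Rightarrow> nat \<Rightarrow>\<^sub>0 nat" where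
  "rect_expo n b = expo n (\<lambda>_. b)"

lemma rect_expo_Suc: "rect_expo (Suc n) b = Poly_Mapping.single n b + rect_expo n b"
  by (simp add: rect_expo_def expo_def add.commute)

lemma rect_expo_add: "rect_expo n (a + b) = rect_expo n a + rect_expo n b"
  by (simp add: rect_expo_def expo_def single_add sum.distrib)

lemma gtschur_Suc_short:
  assumes "\<alpha> \<in> par"
  shows "gtschur (Suc n) \<alpha> = (\<Sum>\<mu> | hstrip \<mu> \<alpha> \<and> \<mu> n = 0. xpow n (psize \<alpha> - psize \<mu>) * gtschur n \<mu>)"
  unfolding gtschur.simps
  by (rule sum.mono_neutral_right[OF finite_hstrip_inner[OF assms]]) (auto simp: gtschur_long)

text \<open>Every level of a Gelfand-Tsetlin pattern is complemented in a box with as many rows as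
  there are variables at that level. Consecutive boxes differ by \<open>b\<close> cells, so the two
  exponents of the removed variable add up to \<open>b\<close>.\<close>

lemma reversal_gtschur:
  assumes "in_box n b \<alpha>"
  shows "reversal (rect_expo n b) (gtschur n \<alpha>) (gtschur n (box_complement n b \<alpha>))"
  using assms
proof (induction n arbitrary: \<alpha>)
  case 0
  have "\<alpha> = (\<lambda>_. 0)" using in_box_zero[OF 0] by auto
  moreover have "box_complement 0 b \<alpha> = (\<lambda>_. 0)" by (auto simp: box_complement_def)
  ultimately show ?case using reversal_one[of 0] by (simp add: rect_expo_def expo_def)
next
  case (Suc n)
  let ?c = "box_complement (Suc n) b \<alpha>"
  have cb: "in_box (Suc n) b ?c" using Suc.prems by (rule in_box_complement)
  let ?I = "\<lambda>\<alpha>. {\<mu>. hstrip \<mu> \<alpha> \<and> \<mu> n = 0}"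
  let ?g = "\<lambda>\<mu>. xpow n (psize ?c - psize (box_complement n b \<mu>)) * gtschur n (box_complement n b \<mu>)"
  have "gtschur (Suc n) ?c = (\<Sum>\<mu>\<in>?I ?c. xpow n (psize ?c - psize \<mu>) * gtschur n \<mu>)"
    using cb by (intro gtschur_Suc_short) (simp add: in_box_def)
  also have "\<dots> = (\<Sum>\<mu>\<in>?I \<alpha>. ?g \<mu>)"
  proof (rule sum.reindex_bij_witness[of _ "box_complement n b" "box_complement n b"], goal_cases)
    case (1 a)
    then show ?case using hstrip_box_complement(1)[OF cb] box_complement_involutive by simp
  next
    case (2 a)
    then show ?case using hstrip_box_complement(2)[OF cb, of a] box_complement_involutive[OF Suc.prems]
      by (simp add: box_complement_def)
  next
    case (3 a)
    then show ?case using hstrip_box_complement(1)[OF Suc.prems] box_complement_involutive by simp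
  next
    case (4 a)
    then show ?case using hstrip_box_complement(2)[OF Suc.prems, of a] by (simp add: box_complement_def)
  next
    case (5 a)
    then show ?case using hstrip_box_complement(1)[OF cb] box_complement_involutive by simp
  qed
  finally have c: "gtschur (Suc n) ?c = (\<Sum>\<mu>\<in>?I \<alpha>. ?g \<mu>)" .
  have a: "gtschur (Suc n) \<alpha> = (\<Sum>\<mu>\<in>?I \<alpha>. xpow n (psize \<alpha> - psize \<mu>) * gtschur n \<mu>)"
    using Suc.prems by (intro gtschur_Suc_short) (simp add: in_box_def)
  show ?case unfolding a c
  proof (rule reversal_sum)
    fix \<mu> assume m: "\<mu> \<in> ?I \<alpha>"
    then have ib: "in_box n b \<mu>" using hstrip_box_complement(1)[OF Suc.prems] by simp
    have "psize \<mu> \<le> psize \<alpha>" using m Suc.prems hstrip_psize by (auto simp: in_box_def)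
    moreover have "psize (box_complement n b \<mu>) \<le> psize ?c"
      using m cb hstrip_box_complement(2)[OF Suc.prems] hstrip_psize by (auto simp: in_box_def)
    ultimately have "(psize \<alpha> - psize \<mu>) + (psize ?c - psize (box_complement n b \<mu>)) = b"
      using psize_box_complement[OF ib] psize_box_complement[OF Suc.prems] by simp
    then have "reversal (Poly_Mapping.single n b) (xpow n (psize \<alpha> - psize \<mu>))
        (xpow n (psize ?c - psize (box_complement n b \<mu>)))"
      unfolding xpow_def by (intro reversal.single) (simp add: single_add[symmetric])
    then show "reversal (rect_expo (Suc n) b) (xpow n (psize \<alpha> - psize \<mu>) * gtschur n \<mu>) (?g \<mu>)"
      unfolding rect_expo_Suc using Suc.IH[OF ib] by (rule reversal_mult)
  qed
qed

text \<open>Both expansions are pushed forward to the common index set \<open>C\<close>, where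
  independence applies to their difference. The injections allow sums indexed by lists, complements
  or shifted partitions.\<close>

lemma gtschur_compare_coefficients:
  fixes w :: "'a \<Rightarrow> int" and w' :: "'b \<Rightarrow> int"
  assumes fin: "finite A" "finite A'" and inj: "inj_on \<phi> A" "inj_on \<psi> A'"
    and A: "\<And>\<nu>. \<nu> \<in> A \<Longrightarrow> \<phi> \<nu> \<in> par \<and> \<phi> \<nu> n = 0"
    and A': "\<And>\<nu>. \<nu> \<in> A' \<Longrightarrow> \<psi> \<nu> \<in> par \<and> \<psi> \<nu> n = 0"
    and eq: "(\<Sum>\<nu>\<in>A. of_int (w \<nu>) * gtschur n (\<phi> \<nu>)) = (\<Sum>\<nu>\<in>A'. of_int (w' \<nu>) * gtschur n (\<psi> \<nu>))"
    and a: "a \<in> A" "a' \<in> A'" "\<phi> a = \<psi> a'"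
  shows "w a = w' a'"
proof -
  define C where "C = \<phi> ` A \<union> \<psi> ` A'"
  define p where "p = (\<lambda>\<rho>. if \<rho> \<in> \<phi> ` A then w (inv_into A \<phi> \<rho>) else 0)"
  define q where "q = (\<lambda>\<rho>. if \<rho> \<in> \<psi> ` A' then w' (inv_into A' \<psi> \<rho>) else 0)"
  have "finite C" using fin by (simp add: C_def)
  have "(\<Sum>\<rho>\<in>C. of_int (p \<rho>) * gtschur n \<rho>) = (\<Sum>\<rho>\<in>\<phi> ` A. of_int (p \<rho>) * gtschur n \<rho>)"
    using \<open>finite C\<close> by (intro sum.mono_neutral_right) (auto simp: C_def p_def)
  also have "\<dots> = (\<Sum>\<nu>\<in>A. of_int (w \<nu>) * gtschur n (\<phi> \<nu>))"
    using inj(1) by (simp add: sum.reindex p_def)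
  finally have P: "(\<Sum>\<rho>\<in>C. of_int (p \<rho>) * gtschur n \<rho>) = (\<Sum>\<nu>\<in>A. of_int (w \<nu>) * gtschur n (\<phi> \<nu>))" .
  have "(\<Sum>\<rho>\<in>C. of_int (q \<rho>) * gtschur n \<rho>) = (\<Sum>\<rho>\<in>\<psi> ` A'. of_int (q \<rho>) * gtschur n \<rho>)"
    using \<open>finite C\<close> by (intro sum.mono_neutral_right) (auto simp: C_def q_def)
  also have "\<dots> = (\<Sum>\<nu>\<in>A'. of_int (w' \<nu>) * gtschur n (\<psi> \<nu>))"
    using inj(2) by (simp add: sum.reindex q_def)
  finally have "(\<Sum>\<rho>\<in>C. of_int (p \<rho> - q \<rho>) * gtschur n \<rho>) = 0"
    using P eq by (simp add: left_diff_distrib sum_subtractf)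
  moreover have "\<rho> \<in> par \<and> \<rho> n = 0" if "\<rho> \<in> C" for \<rho> using that A A' by (auto simp: C_def)
  moreover have "\<phi> a \<in> C" using a by (simp add: C_def)
  ultimately have "p (\<phi> a) - q (\<phi> a) = 0"
    using gtschur_independent[OF \<open>finite C\<close>, of n "\<lambda>\<rho>. p \<rho> - q \<rho>" "\<phi> a"] by blast
  moreover have "p (\<phi> a) = w a" using a(1) inj(1) by (simp add: p_def)
  moreover have "q (\<phi> a) = w' a'" using a(2,3) inj(2) by (simp add: q_def)
  ultimately show ?thesis by simp
qed

text \<open>Reversing twice: \<open>\<nu>\<close> is complemented in a box of width
  \<open>\<nu> 0\<close>, and the result in a box wider by \<open>e\<close>. This adds
  \<open>e\<close> columns of length \<open>n\<close> and multiplies by the \<open>e\<close>-th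
  power of the product of all variables.\<close>

lemma gtschur_shift:
  assumes "\<nu> \<in> par" "\<nu> n = 0"
  shows "gtschur n \<nu> * Poly_Mapping.single (rect_expo n e) 1 = gtschur n (\<lambda>i. if i < n then \<nu> i + e else 0)"
proof -
  have b: "in_box n (\<nu> 0) \<nu>" using assms by (simp add: in_box_def)
  let ?c = "box_complement n (\<nu> 0) \<nu>"
  have c: "in_box n (\<nu> 0) ?c" using b by (rule in_box_complement)
  then have c': "in_box n (\<nu> 0 + e) ?c" by (simp add: in_box_def)
  have "reversal (rect_expo n (\<nu> 0 + e)) (gtschur n ?c * 1) (gtschur n \<nu> * Poly_Mapping.single (rect_expo n e) 1)"
    unfolding rect_expo_add
    using reversal_mult[OF reversal_gtschur[OF c] reversal_one] by (simp add: box_complement_involutive[OF b])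
  moreover have "reversal (rect_expo n (\<nu> 0 + e)) (gtschur n ?c * 1) (gtschur n (box_complement n (\<nu> 0 + e) ?c))"
    using reversal_gtschur[OF c'] by simp
  moreover have "box_complement n (\<nu> 0 + e) ?c = (\<lambda>i. if i < n then \<nu> i + e else 0)"
    using in_box_le[OF b] by (auto simp: box_complement_def fun_eq_iff)
  ultimately show ?thesis using reversal_unique by metis
qed

text \<open>Partitions \<open>\<nu>\<close> occurring in \<open>f\<close> need not be known to fit into the box of width \<open>m\<close>, so the
  complement is taken in the wider box of width \<open>m + d\<close>, at the price of a shift by \<open>d\<close> on the
  other side.\<close>

lemma complement_coefficient:
  fixes w w' :: "(nat \<Rightarrow> nat) \<Rightarrow> int"
  assumes f: "f = (\<Sum>\<nu>\<in>parts d. of_int (w \<nu>) * gtschur n \<nu>)"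
    and g: "g = (\<Sum>\<nu>\<in>parts d'. of_int (w' \<nu>) * gtschur n \<nu>)"
    and r: "reversal (rect_expo n m) f g"
    and \<nu>: "\<nu> \<in> parts d" "in_box n m \<nu>" "box_complement n m \<nu> \<in> parts d'"
  shows "w \<nu> = w' (box_complement n m \<nu>)"
proof -
  let ?A = "{\<nu>\<in>parts d. \<nu> n = 0}" and ?A' = "{\<nu>\<in>parts d'. \<nu> n = 0}"
  let ?c = "box_complement n (m + d)" and ?s = "\<lambda>\<nu> i. if i < n then \<nu> i + d else (0::nat)"
  have f': "f = (\<Sum>\<nu>\<in>?A. of_int (w \<nu>) * gtschur n \<nu>)"
    unfolding f by (rule sum.mono_neutral_right) (auto simp: gtschur_long)
  have g': "g = (\<Sum>\<nu>\<in>?A'. of_int (w' \<nu>) * gtschur n \<nu>)"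
    unfolding g by (rule sum.mono_neutral_right) (auto simp: gtschur_long)
  have box: "in_box n (m + d) \<mu>" if "\<mu> \<in> ?A" for \<mu>
    using that parts_le[of \<mu> d 0] by (simp add: in_box_def parts_def)
  have "reversal (rect_expo n (m + d)) f (\<Sum>\<nu>\<in>?A. of_int (w \<nu>) * gtschur n (?c \<nu>))"
    unfolding f' by (intro reversal_sum reversal_of_int reversal_gtschur box)
  moreover have "reversal (rect_expo n (m + d)) f (g * Poly_Mapping.single (rect_expo n d) 1)"
    using reversal_mult[OF r reversal_one] by (simp add: rect_expo_add)
  ultimately have "(\<Sum>\<nu>\<in>?A. of_int (w \<nu>) * gtschur n (?c \<nu>)) = g * Poly_Mapping.single (rect_expo n d) 1"
    by (rule reversal_unique)
  also have "\<dots> = (\<Sum>\<nu>\<in>?A'. of_int (w' \<nu>) * gtschur n (?s \<nu>))"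
    unfolding g' sum_distrib_right
    by (intro sum.cong refl) (simp add: mult.assoc gtschur_shift parts_def)
  finally have eq: "(\<Sum>\<nu>\<in>?A. of_int (w \<nu>) * gtschur n (?c \<nu>)) = (\<Sum>\<nu>\<in>?A'. of_int (w' \<nu>) * gtschur n (?s \<nu>))" .
  show ?thesis
  proof (rule gtschur_compare_coefficients[OF _ _ _ _ _ _ eq])
    show "inj_on ?c ?A" using box box_complement_involutive by (metis (no_types, lifting) inj_onI)
    show "inj_on ?s ?A'"
    proof (rule inj_onI, rule ext)
      fix x y i assume xy: "x \<in> ?A'" "y \<in> ?A'" "?s x = ?s y"
      show "x i = y i"
      proof (cases "i < n")
        case True
        then show ?thesis using fun_cong[OF xy(3), of i] by simp
      next
        case False
        then show ?thesis using xy par_zeroD[of x n i] par_zeroD[of y n i] by (simp add: parts_def)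
      qed
    qed
    show "?c \<mu> \<in> par \<and> ?c \<mu> n = 0" if "\<mu> \<in> ?A" for \<mu>
      using in_box_complement[OF box[OF that]] by (simp add: in_box_def)
    show "?s \<mu> \<in> par \<and> ?s \<mu> n = 0" if "\<mu> \<in> ?A'" for \<mu>
    proof
      have "\<mu> \<in> par" using that by (simp add: parts_def)
      then show "?s \<mu> \<in> par" by (intro parI[of _ n]) (auto simp: par_def)
    qed simp
    show "\<nu> \<in> ?A" using \<nu> by (simp add: in_box_def)
    show "box_complement n m \<nu> \<in> ?A'" using \<nu> by (simp add: box_complement_def)
    \<comment> \<open>Since \<open>\<nu>\<close> fits into width \<open>m\<close>, widening the box
      by \<open>d\<close> adds exactly \<open>d\<close> to each of the \<open>n\<close> rows of its
      complement.\<close>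
    show "?c \<nu> = ?s (box_complement n m \<nu>)"
      using in_box_le[OF \<nu>(2)] by (auto simp: box_complement_def fun_eq_iff)
  qed auto
qed

section \<open>Littlewood--Richardson coefficients\<close>

definition part_fun :: "nat list \<Rightarrow> nat \<Rightarrow> nat" where
  "part_fun lam i = (if i < length lam then lam ! i else 0)"

lemma cells_eq_diagram: "cells lam = diagram (part_fun lam)"
  by (auto simp: cells_def diagram_def part_fun_def split: if_splits)

lemma psize_part_fun: "psize (part_fun lam) = sum_list lam"
  by (subst psize_eq_sum[of "length lam"]) (auto simp: part_fun_def sum_list_sum_nth atLeast0LessThan)

lemma part_fun_par:
  assumes "is_partition lam" shows "part_fun lam \<in> par"
  using assms
  by (intro parI[of _ "length lam"]) (auto simp: part_fun_def is_partition_def sorted_wrt_iff_nth_less)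

lemma schur_eq_gtschur:
  assumes "is_partition lam" shows "schur n lam = gtschur n (part_fun lam)"
  unfolding schur_def ssyt_def tab_monomial_def cells_eq_diagram
  using gtschur_eq_tableaux_sum[OF part_fun_par[OF assms], of n]
  by (simp add: tableaux_def weight_def)

text \<open>\<open>conjugate p 0\<close> counts the nonzero rows. As \<open>is_partition\<close>
  excludes zero parts, cutting the sequence there recovers the list.\<close>

lemma bij_betw_part_fun: "bij_betw part_fun {nu. is_partition nu \<and> sum_list nu = d} (parts d)"
proof (rule bij_betwI[where g = "\<lambda>p. map p [0..<conjugate p 0]"])
  show "part_fun \<in> {nu. is_partition nu \<and> sum_list nu = d} \<rightarrow> parts d"
    by (auto simp: parts_def part_fun_par psize_part_fun)
  have inv: "part_fun (map p [0..<conjugate p 0]) = p" if "p \<in> par" for p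
    using less_conjugate_iff[OF that, of _ 0] by (auto simp: part_fun_def fun_eq_iff)
  then show "part_fun (map p [0..<conjugate p 0]) = p" if "p \<in> parts d" for p
    using that by (simp add: parts_def)
  show "(\<lambda>p. map p [0..<conjugate p 0]) \<in> parts d \<rightarrow> {nu. is_partition nu \<and> sum_list nu = d}"
  proof
    fix p assume "p \<in> parts d"
    then have p: "p \<in> par" "psize p = d" by (auto simp: parts_def)
    have "is_partition (map p [0..<conjugate p 0])"
      unfolding is_partition_def
    proof
      show "sorted_wrt (\<ge>) (map p [0..<conjugate p 0])"
        by (simp add: sorted_wrt_iff_nth_less par_antimono[OF p(1)])
    qed (simp add: less_conjugate_iff[OF p(1)])
    then show "map p [0..<conjugate p 0] \<in> {nu. is_partition nu \<and> sum_list nu = d}"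
      using inv[OF p(1)] p(2) psize_part_fun[of "map p [0..<conjugate p 0]"] by simp
  qed
  show "map (part_fun nu) [0..<conjugate (part_fun nu) 0] = nu"
    if "nu \<in> {nu. is_partition nu \<and> sum_list nu = d}" for nu
  proof -
    have nu: "is_partition nu" using that by simp
    have "i < conjugate (part_fun nu) 0 \<longleftrightarrow> i < length nu" for i
      unfolding less_conjugate_iff[OF part_fun_par[OF nu]]
      using nu by (auto simp: part_fun_def is_partition_def)
    then have "conjugate (part_fun nu) 0 = length nu" by (rule eq_if_same_below)
    then show ?thesis by (intro nth_equalityI) (auto simp: part_fun_def)
  qed
qed

text \<open>Any expansion in \<open>d\<close> variables will do: partitions of \<open>d\<close> have
  at most \<open>d\<close> rows, so independence gives the uniqueness that the definite description
  requires.\<close>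

lemma lr_coeff_eqI:
  fixes u :: "(nat \<Rightarrow> nat) \<Rightarrow> int"
  assumes lams: "\<And>lam. lam \<in> set lams \<Longrightarrow> is_partition lam"
    and d: "d = sum_list (map sum_list lams)"
    and prod: "prod_list (map (\<lambda>lam. gtschur d (part_fun lam)) lams)
      = (\<Sum>\<nu>\<in>parts d. of_int (u \<nu>) * gtschur d \<nu>)"
    and mu: "is_partition mu" "sum_list mu = d"
  shows "lr_coeff lams mu = u (part_fun mu)"
proof -
  define P where "P = {nu. is_partition nu \<and> sum_list nu = d}"
  define Q where "Q = (\<lambda>c. (\<forall>nu. nu \<notin> P \<longrightarrow> c nu = 0) \<and> prod_list (map (schur d) lams) =
                 (\<Sum>nu\<in>P. Poly_Mapping.single 0 (c nu) * schur d nu))"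
  have bij: "bij_betw part_fun P (parts d)" unfolding P_def by (rule bij_betw_part_fun)
  have finP: "finite P" using bij finite_parts bij_betw_finite by blast
  have sc: "(\<Sum>nu\<in>P. Poly_Mapping.single 0 (c nu) * schur d nu)
      = (\<Sum>nu\<in>P. of_int (c nu) * gtschur d (part_fun nu))" for c
    by (intro sum.cong refl) (simp add: P_def schur_eq_gtschur of_int_mpoly)
  have "map (schur d) lams = map (\<lambda>lam. gtschur d (part_fun lam)) lams"
    using lams by (simp add: schur_eq_gtschur)
  then have pr: "prod_list (map (schur d) lams) = (\<Sum>\<nu>\<in>parts d. of_int (u \<nu>) * gtschur d \<nu>)"
    using prod by (simp only:)
  \<comment> \<open>The value 0 outside \<open>P\<close> is part of the condition that
    \<open>lr_coeff\<close> imposes.\<close>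
  define c0 where "c0 = (\<lambda>nu. if nu \<in> P then u (part_fun nu) else 0)"
  have "(THE c. Q c) = c0"
  proof (rule the_equality)
    have "(\<Sum>nu\<in>P. of_int (c0 nu) * gtschur d (part_fun nu))
        = (\<Sum>nu\<in>P. of_int (u (part_fun nu)) * gtschur d (part_fun nu))"
      by (rule sum.cong) (auto simp: c0_def)
    also have "\<dots> = (\<Sum>\<nu>\<in>parts d. of_int (u \<nu>) * gtschur d \<nu>)"
      using bij by (rule sum.reindex_bij_betw)
    finally show "Q c0" unfolding Q_def sc pr by (simp add: c0_def)
    fix c assume c: "Q c"
    show "c = c0"
    proof
      fix nu
      show "c nu = c0 nu"
      proof (cases "nu \<in> P")
        case True
        have eq: "(\<Sum>nu\<in>P. of_int (c nu) * gtschur d (part_fun nu)) = (\<Sum>\<nu>\<in>parts d. of_int (u \<nu>) * gtschur d \<nu>)"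
          using c unfolding Q_def sc pr by simp
        have img: "part_fun nu \<in> parts d" if "nu \<in> P" for nu using that bij by (auto simp: bij_betw_def)
        have pd: "\<nu> \<in> par \<and> \<nu> d = 0" if "\<nu> \<in> parts d" for \<nu>
          using that parts_length[OF that] by (simp add: parts_def)
        have "c nu = u (part_fun nu)"
          by (rule gtschur_compare_coefficients[where \<phi> = part_fun and \<psi> = "\<lambda>\<nu>. \<nu>", OF finP finite_parts _ _ _ _ eq])
            (use bij True img pd in \<open>auto simp: bij_betw_def\<close>)
        then show ?thesis using True by (simp add: c0_def)
      next
        case False
        then show ?thesis using c by (simp add: Q_def c0_def)
      qed
    qed
  qed
  moreover have "lr_coeff lams mu = (THE c. Q c) mu"
    unfolding lr_coeff_def Let_def Q_def P_def d ..
  moreover have "mu \<in> P" using mu by (simp add: P_def)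
  ultimately show ?thesis by (simp add: c0_def)
qed

section \<open>Rectangles and the comparison in \<open>M\<close> variables\<close>

definition rect_fun :: "nat \<Rightarrow> nat \<Rightarrow> nat \<Rightarrow> nat" where
  "rect_fun a b i = (if i < b then a else 0)"

lemma rect_fun_par [simp]: "rect_fun a b \<in> par"
  by (rule parI[of _ b]) (auto simp: rect_fun_def)

lemma psize_rect_fun [simp]: "psize (rect_fun a b) = a * b"
  by (subst psize_eq_sum[of b]) (auto simp: rect_fun_def)

lemma part_fun_rect: "part_fun (rect a b) = rect_fun a b"
  by (auto simp: part_fun_def rect_def rect_fun_def fun_eq_iff)

lemma is_partition_rect: "is_partition (rect a b)"
  by (auto simp: is_partition_def rect_def sorted_wrt_iff_nth_less)

lemma sum_list_rect: "sum_list (rect a b) = a * b"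
  by (simp add: rect_def sum_list_replicate mult.commute)

lemma conjugate_rect_fun: "conjugate (rect_fun a b) = rect_fun b a"
  by (rule ext, rule eq_if_same_below) (auto simp: less_conjugate_iff rect_fun_def)

lemma bij_betw_conjugate: "bij_betw conjugate (parts d) (parts d)"
  by (rule bij_betwI[of _ _ _ conjugate]) (auto simp: parts_def)

text \<open>The coefficient is read off in \<open>a * M\<close> variables, yet the same
  \<open>w\<close> expands the conjugate product for every \<open>n\<close>; this allows the later
  passage to \<open>M\<close> variables.\<close>

lemma rect_lr_coeff_conjugate:
  fixes L :: "nat list"
  defines "M \<equiv> sum_list L"
  obtains w where "lr_coeff (map (\<lambda>l. rect a l) L) (rect M a) = w (rect_fun a M)"
    and "\<And>n. prod_list (map (\<lambda>l. gtschur n (rect_fun l a)) L)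
      = (\<Sum>\<nu>\<in>parts (a * M). of_int (w \<nu>) * gtschur n \<nu>)"
proof -
  have size: "sum_list (map psize (map (rect_fun a) L)) = a * M"
    unfolding M_def by (induction L) (auto simp: distrib_left)
  have "conj_expansion (a * M) (\<lambda>n. prod_list (map (gtschur n) (map (rect_fun a) L)))
    (\<lambda>n. prod_list (map (\<lambda>\<alpha>. gtschur n (conjugate \<alpha>)) (map (rect_fun a) L)))"
    unfolding size[symmetric] by (rule conj_expansion_prod) auto
  then obtain u where
    u: "\<And>n. prod_list (map (\<lambda>l. gtschur n (rect_fun a l)) L) = (\<Sum>\<nu>\<in>parts (a * M). of_int (u \<nu>) * gtschur n \<nu>)"
    and u': "\<And>n. prod_list (map (\<lambda>l. gtschur n (rect_fun l a)) L)
      = (\<Sum>\<nu>\<in>parts (a * M). of_int (u \<nu>) * gtschur n (conjugate \<nu>))"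
    unfolding conj_expansion_def by (auto simp: o_def conjugate_rect_fun)
  have d: "a * M = sum_list (map sum_list (map (rect a) L))"
    unfolding M_def by (induction L) (auto simp: distrib_left sum_list_rect)
  have "lr_coeff (map (rect a) L) (rect M a) = u (part_fun (rect M a))"
    by (rule lr_coeff_eqI[OF _ d])
      (auto simp: is_partition_rect sum_list_rect part_fun_rect o_def u)
  then have "lr_coeff (map (\<lambda>l. rect a l) L) (rect M a) = u (conjugate (rect_fun a M))"
    by (simp add: part_fun_rect conjugate_rect_fun)
  \<comment> \<open>Taking \<open>w\<close> to be \<open>u\<close> after \<open>conjugate\<close>
    reindexes the conjugate expansion as an ordinary one.\<close>
  moreover have "prod_list (map (\<lambda>l. gtschur n (rect_fun l a)) L)
      = (\<Sum>\<nu>\<in>parts (a * M). of_int (u (conjugate \<nu>)) * gtschur n \<nu>)" for n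
  proof -
    have "(\<Sum>\<nu>\<in>parts (a * M). of_int (u \<nu>) * gtschur n (conjugate \<nu>))
      = (\<Sum>\<nu>\<in>parts (a * M). of_int (u (conjugate \<nu>)) * gtschur n (conjugate (conjugate \<nu>)))"
      by (rule sum.reindex_bij_betw[OF bij_betw_conjugate, symmetric])
    also have "\<dots> = (\<Sum>\<nu>\<in>parts (a * M). of_int (u (conjugate \<nu>)) * gtschur n \<nu>)"
      by (rule sum.cong) (auto simp: parts_def)
    finally show ?thesis using u' by simp
  qed
  ultimately show ?thesis by (rule that)
qed

lemma in_box_rect_fun: "b \<le> n \<Longrightarrow> a \<le> c \<Longrightarrow> in_box n c (rect_fun a b)"
  by (simp add: in_box_def rect_fun_def)

lemma box_complement_rect_fun_columns:
  "b \<le> n \<Longrightarrow> box_complement n a (rect_fun a b) = rect_fun a (n - b)"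
  by (auto simp: box_complement_def rect_fun_def fun_eq_iff)

lemma box_complement_rect_fun_full:
  "box_complement n c (rect_fun a n) = rect_fun (c - a) n"
  by (auto simp: box_complement_def rect_fun_def fun_eq_iff)

theorem theorem6p5:
  fixes N M :: nat and L :: "nat list"
  assumes "0 < N"
    and "sorted_wrt (\<ge>) L"
    and "\<forall>l\<in>set L. l \<le> N"
    and "M = sum_list L"
    and "M \<ge> N"
  shows "lr_coeff (map (\<lambda>l. rect N l) L) (rect M N)
       = lr_coeff (map (\<lambda>l. rect (M - N) l) L) (rect M (M - N))"
proof -
  obtain w where w: "lr_coeff (map (\<lambda>l. rect N l) L) (rect M N) = w (rect_fun N M)"
    "\<And>n. prod_list (map (\<lambda>l. gtschur n (rect_fun l N)) L)
      = (\<Sum>\<nu>\<in>parts (N * M). of_int (w \<nu>) * gtschur n \<nu>)"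
    using rect_lr_coeff_conjugate[of N L] unfolding assms(4)[symmetric] by blast
  obtain w' where w': "lr_coeff (map (\<lambda>l. rect (M - N) l) L) (rect M (M - N)) = w' (rect_fun (M - N) M)"
    "\<And>n. prod_list (map (\<lambda>l. gtschur n (rect_fun l (M - N))) L)
      = (\<Sum>\<nu>\<in>parts ((M - N) * M). of_int (w' \<nu>) * gtschur n \<nu>)"
    using rect_lr_coeff_conjugate[of "M - N" L] unfolding assms(4)[symmetric] by blast
  have "sum_list (map (rect_expo M) L) = rect_expo M (sum_list L)"
  proof (induction L)
    case Nil
    show ?case by (simp add: rect_expo_def expo_def)
  qed (simp add: rect_expo_add)
  moreover have "reversal (rect_expo M l) (gtschur M (rect_fun l N)) (gtschur M (rect_fun l (M - N)))" for l
    \<comment> \<open>The box width \<open>l\<close> equals the row length, so full rows become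
      empty and the \<open>M - N\<close> empty rows become full.\<close>
    using reversal_gtschur[OF in_box_rect_fun[OF assms(5) order_refl, of l]]
    by (simp add: box_complement_rect_fun_columns[OF assms(5)])
  then have "reversal (sum_list (map (rect_expo M) L))
      (prod_list (map (\<lambda>l. gtschur M (rect_fun l N)) L))
      (prod_list (map (\<lambda>l. gtschur M (rect_fun l (M - N))) L))"
    by (intro reversal_prod_list)
  ultimately have r: "reversal (rect_expo M M)
      (prod_list (map (\<lambda>l. gtschur M (rect_fun l N)) L))
      (prod_list (map (\<lambda>l. gtschur M (rect_fun l (M - N))) L))"
    using assms(4) by simp
  have "w (rect_fun N M) = w' (box_complement M M (rect_fun N M))"
    by (rule complement_coefficient[OF w(2) w'(2) r])
      (use assms(5) in \<open>auto simp: parts_def in_box_rect_fun box_complement_rect_fun_full\<close>)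
  then show ?thesis using w(1) w'(1) by (simp add: box_complement_rect_fun_full)
qed

end
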